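(* Let $\ell\geq 1$. Any indecomposable NIM-representation of the fusion rule $\mathrm{Fib}^{\ell}$ is isomorphic to $\mathrm{Fib}^{\lambda}$ for some set-theoretic partition $\lambda$ of $[\ell]=\{1,\dots,\ell\}$.
   Context: A fusion rule is a set $R$ such that $\mathbb{Z}R$ (free abelian group on $R$) is an associative unital ring whose unit belongs to $R$, with $r\cdot s\in\mathbb{Z}_{\ge0}R$ for $r,s\in R$, together with an involution $(-)^*:R\to R$ such that $(r\cdot s,t)=(s,r^*t)$ for $r,s,t\in R$, where $(\cdot,\cdot)$ is the symmetric bilinear form with $(r,s)=\delta_{r,s}$. A NIM-representation of $R$ is a set $M$ with a $\mathbb{Z}R$-module structure on $\mathbb{Z}M$ such that $r\ast m\in\mathbb{Z}_{\ge0}M$ for $r\in R$, $m\in M$, and $(r\ast m,n)=(m,r^*\ast n)$ for $r\in R$, $m,n\in M$, where $(m,n)=\delta_{m,n}$ on $\mathbb{Z}M$. A morphism of NIM-representations is a map of sets inducing a $\mathbb{Z}R$-module homomorphism. A NIM-representation is indecomposable if it is non-empty and is not the disjoint union of two non-empty NIM-subrepresentations. The Fibonacci fusion rule is $\mathrm{Fib}=\{1,x\}$ with $x^2=1+x$ and $x^*=x$. $\mathrm{Fib}^\ell$ is the product fusion rule, with ring $\mathbb{Z}[\mathrm{Fib}]^{\otimes\ell}$; $x_i$ denotes the element with $x$ in the $i$-th place and $1$ elsewhere, so elements of $\mathrm{Fib}^\ell$ are the products $x_1^{\epsilon_1}\cdots x_\ell^{\epsilon_\ell}$, $\epsilon\in\{0,1\}^\ell$.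 For a partition $\lambda$ of $[\ell]$ into $k$ parts $\lambda_1,\dots,\lambda_k$, $\mathrm{Fib}^\lambda$ is the NIM-representation of $\mathrm{Fib}^\ell$ with underlying set $\mathrm{Fib}^k$, on which $x_i$ acts as multiplication by the $j$-th generator $x_j\in\mathrm{Fib}^k$ whenever $i\in\lambda_j$. *)

theory Defs
  imports "HOL-Algebra.Free_Abelian_Groups" "HOL-Algebra.Ring" "HOL-Library.Disjoint_Sets"
begin

text \<open>
  The free abelian group on a set \<open>S\<close> is \<^const>\<open>free_Abelian_group\<close>, consisting of the
  finitely supported functions \<^typ>\<open>'a \<Rightarrow>\<^sub>0 int\<close> supported in \<open>S\<close>; the basis vector of
  \<open>r \<in> S\<close> is \<open>frag_of r\<close>.
\<close>

abbreviation ZZ :: "'a set \<Rightarrow> ('a \<Rightarrow>\<^sub>0 int) set" where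
  "ZZ S \<equiv> carrier (free_Abelian_group S)"

definition nonneg :: "('a \<Rightarrow>\<^sub>0 int) \<Rightarrow> bool" where
  "nonneg c \<longleftrightarrow> (\<forall>s. 0 \<le> Poly_Mapping.lookup c s)"

definition form :: "('a \<Rightarrow>\<^sub>0 int) \<Rightarrow> ('a \<Rightarrow>\<^sub>0 int) \<Rightarrow> int" where
  "form c d = (\<Sum>s\<in>Poly_Mapping.keys c. Poly_Mapping.lookup c s * Poly_Mapping.lookup d s)"

definition bilinear_extend ::
  "('a \<Rightarrow> 'b \<Rightarrow> ('c \<Rightarrow>\<^sub>0 int)) \<Rightarrow> ('a \<Rightarrow>\<^sub>0 int) \<Rightarrow> ('b \<Rightarrow>\<^sub>0 int) \<Rightarrow> ('c \<Rightarrow>\<^sub>0 int)" where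
  "bilinear_extend f a b = frag_extend (\<lambda>r. frag_extend (f r) b) a"


record 'r fusion_data =
  fus_basis :: "'r set"
  fus_mult :: "('r \<Rightarrow>\<^sub>0 int) \<Rightarrow> ('r \<Rightarrow>\<^sub>0 int) \<Rightarrow> ('r \<Rightarrow>\<^sub>0 int)"
  fus_unit :: 'r
  fus_dual :: "'r \<Rightarrow> 'r"

definition fusion_ring :: "'r fusion_data \<Rightarrow> ('r \<Rightarrow>\<^sub>0 int) ring" where
  "fusion_ring R = \<lparr>carrier = ZZ (fus_basis R), mult = fus_mult R,
     one = frag_of (fus_unit R), zero = 0, add = (+)\<rparr>"

definition fusion_rule :: "'r fusion_data \<Rightarrow> bool" where
  "fusion_rule R \<longleftrightarrow>
     fus_unit R \<in> fus_basis R \<and>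
     ring (fusion_ring R) \<and>
     (\<forall>r\<in>fus_basis R. \<forall>s\<in>fus_basis R. nonneg (fus_mult R (frag_of r) (frag_of s))) \<and>
     (\<forall>r\<in>fus_basis R. fus_dual R r \<in> fus_basis R \<and> fus_dual R (fus_dual R r) = r) \<and>
     (\<forall>r\<in>fus_basis R. \<forall>s\<in>fus_basis R. \<forall>t\<in>fus_basis R.
        form (fus_mult R (frag_of r) (frag_of s)) (frag_of t) =
        form (frag_of s) (fus_mult R (frag_of (fus_dual R r)) (frag_of t)))"


record ('r, 'm) nim_data =
  nim_set :: "'m set"
  nim_act :: "('r \<Rightarrow>\<^sub>0 int) \<Rightarrow> ('m \<Rightarrow>\<^sub>0 int) \<Rightarrow> ('m \<Rightarrow>\<^sub>0 int)"

text \<open>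
  The first five clauses of \<open>nim_rep\<close> say that \<open>ZZ M\<close> is a left module over the fusion ring.
  They are written out because the locale \<open>module\<close> of HOL-Algebra requires a commutative ring.
\<close>

definition nim_rep :: "'r fusion_data \<Rightarrow> ('r, 'm) nim_data \<Rightarrow> bool" where
  "nim_rep R M \<longleftrightarrow>
     (\<forall>a\<in>ZZ (fus_basis R). \<forall>v\<in>ZZ (nim_set M). nim_act M a v \<in> ZZ (nim_set M)) \<and>
     (\<forall>a\<in>ZZ (fus_basis R). \<forall>v\<in>ZZ (nim_set M). \<forall>w\<in>ZZ (nim_set M).
        nim_act M a (v + w) = nim_act M a v + nim_act M a w) \<and>
     (\<forall>a\<in>ZZ (fus_basis R). \<forall>b\<in>ZZ (fus_basis R). \<forall>v\<in>ZZ (nim_set M).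
        nim_act M (a + b) v = nim_act M a v + nim_act M b v) \<and>
     (\<forall>a\<in>ZZ (fus_basis R). \<forall>b\<in>ZZ (fus_basis R). \<forall>v\<in>ZZ (nim_set M).
        nim_act M (fus_mult R a b) v = nim_act M a (nim_act M b v)) \<and>
     (\<forall>v\<in>ZZ (nim_set M). nim_act M (frag_of (fus_unit R)) v = v) \<and>
     (\<forall>r\<in>fus_basis R. \<forall>m\<in>nim_set M. nonneg (nim_act M (frag_of r) (frag_of m))) \<and>
     (\<forall>r\<in>fus_basis R. \<forall>m\<in>nim_set M. \<forall>n\<in>nim_set M.
        form (nim_act M (frag_of r) (frag_of m)) (frag_of n) =
        form (frag_of m) (nim_act M (frag_of (fus_dual R r)) (frag_of n)))"

definition nim_morphism ::
  "'r fusion_data \<Rightarrow> ('r, 'm) nim_data \<Rightarrow> ('r, 'n) nim_data \<Rightarrow> ('m \<Rightarrow> 'n) \<Rightarrow> bool" where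
  "nim_morphism R M N f \<longleftrightarrow>
     f \<in> nim_set M \<rightarrow> nim_set N \<and>
     (\<forall>a\<in>ZZ (fus_basis R). \<forall>v\<in>ZZ (nim_set M).
        frag_extend (\<lambda>m. frag_of (f m)) (nim_act M a v) =
        nim_act N a (frag_extend (\<lambda>m. frag_of (f m)) v))"

definition nim_isomorphic ::
  "'r fusion_data \<Rightarrow> ('r, 'm) nim_data \<Rightarrow> ('r, 'n) nim_data \<Rightarrow> bool" where
  "nim_isomorphic R M N \<longleftrightarrow>
     (\<exists>f g. nim_morphism R M N f \<and> nim_morphism R N M g \<and>
        (\<forall>m\<in>nim_set M. g (f m) = m) \<and> (\<forall>n\<in>nim_set N. f (g n) = n))"

definition nim_subrep :: "'r fusion_data \<Rightarrow> ('r, 'm) nim_data \<Rightarrow> 'm set \<Rightarrow> bool" where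
  "nim_subrep R M A \<longleftrightarrow> A \<subseteq> nim_set M \<and> nim_rep R (M\<lparr>nim_set := A\<rparr>)"

definition nim_indecomposable :: "'r fusion_data \<Rightarrow> ('r, 'm) nim_data \<Rightarrow> bool" where
  "nim_indecomposable R M \<longleftrightarrow>
     nim_set M \<noteq> {} \<and>
     \<not> (\<exists>A B. A \<noteq> {} \<and> B \<noteq> {} \<and> A \<inter> B = {} \<and> A \<union> B = nim_set M \<and>
          nim_subrep R M A \<and> nim_subrep R M B)"


datatype fib = Fib1 | FibX

fun fib_mult :: "fib \<Rightarrow> fib \<Rightarrow> (fib \<Rightarrow>\<^sub>0 int)" where
  "fib_mult Fib1 s = frag_of s"
| "fib_mult FibX Fib1 = frag_of FibX"
| "fib_mult FibX FibX = frag_of Fib1 + frag_of FibX"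

definition Fib :: "fib fusion_data" where
  "Fib = \<lparr>fus_basis = UNIV, fus_mult = bilinear_extend fib_mult, fus_unit = Fib1,
     fus_dual = (\<lambda>r. r)\<rparr>"

text \<open>
  The product of a finite family of fusion rules. Its basis consists of the families
  \<open>(r\<^sub>i)\<close>, standing for the pure tensors of basis elements, and multiplying the tensors of
  \<open>(r\<^sub>i)\<close> and \<open>(s\<^sub>i)\<close> in each factor and expanding gives the coefficient
  \<open>\<Prod>i. (r\<^sub>i s\<^sub>i, t\<^sub>i)\<close> at \<open>(t\<^sub>i)\<close>.
\<close>

definition fusion_product :: "'i set \<Rightarrow> ('i \<Rightarrow> 'r fusion_data) \<Rightarrow> ('i \<Rightarrow> 'r) fusion_data" where
  "fusion_product I R =
     (let c = (\<lambda>r s i. fus_mult (R i) (frag_of (r i)) (frag_of (s i))) in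
      \<lparr>fus_basis = (\<Pi>\<^sub>E i\<in>I. fus_basis (R i)),
       fus_mult = bilinear_extend (\<lambda>r s.
         \<Sum>t\<in>(\<Pi>\<^sub>E i\<in>I. Poly_Mapping.keys (c r s i)).
           frag_cmul (\<Prod>i\<in>I. Poly_Mapping.lookup (c r s i) (t i)) (frag_of t)),
       fus_unit = (\<lambda>i\<in>I. fus_unit (R i)),
       fus_dual = (\<lambda>r. \<lambda>i\<in>I. fus_dual (R i) (r i))\<rparr>)"

definition Fib_power :: "nat \<Rightarrow> (nat \<Rightarrow> fib) fusion_data" where
  "Fib_power l = fusion_product {1..l} (\<lambda>_. Fib)"

definition Fib_gen :: "nat \<Rightarrow> nat \<Rightarrow> (nat \<Rightarrow> fib)" where
  "Fib_gen l i = (\<lambda>j\<in>{1..l}. if j = i then FibX else Fib1)"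

text \<open>
  Here \<open>lam 1, \<dots>, lam k\<close> are the parts of a partition of \<open>{1..l}\<close>. The basis element
  \<open>\<epsilon>\<close> of \<open>Fib_power l\<close> is the product of the generators \<open>x\<^sub>i\<close> with \<open>\<epsilon> i = FibX\<close>, so it acts as
  multiplication by the product of the corresponding generators of \<open>Fib_power k\<close>.
\<close>

definition Fib_partition ::
  "nat \<Rightarrow> nat \<Rightarrow> (nat \<Rightarrow> nat set) \<Rightarrow> (nat \<Rightarrow> fib, nat \<Rightarrow> fib) nim_data" where
  "Fib_partition l k lam =
     (let part = (\<lambda>i. THE j. j \<in> {1..k} \<and> i \<in> lam j) in
      \<lparr>nim_set = fus_basis (Fib_power k),
       nim_act = bilinear_extend (\<lambda>\<epsilon> m.
         fus_mult (Fib_power k)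
           (\<Otimes>\<^bsub>fusion_ring (Fib_power k)\<^esub> i\<in>{i\<in>{1..l}. \<epsilon> i = FibX}. frag_of (Fib_gen k (part i)))
           (frag_of m))\<rparr>)"


lemma frag_extend_superset:
  assumes "finite S" "Poly_Mapping.keys c \<subseteq> S"
  shows "frag_extend f c = (\<Sum>i\<in>S. frag_cmul (Poly_Mapping.lookup c i) (f i))"
  unfolding frag_extend_def using assms
  by (intro sum.mono_neutral_left) (auto simp: in_keys_iff)

lemma lookup_frag_sum: "Poly_Mapping.lookup (\<Sum>i\<in>A. f i) x = (\<Sum>i\<in>A. Poly_Mapping.lookup (f i :: 'a \<Rightarrow>\<^sub>0 int) x)"
  by (induction A rule: infinite_finite_induct) (auto simp: lookup_add)

lemma lookup_frag_extend:
  assumes "finite S" "Poly_Mapping.keys c \<subseteq> S"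
  shows "Poly_Mapping.lookup (frag_extend f c) t =
     (\<Sum>i\<in>S. Poly_Mapping.lookup c i * Poly_Mapping.lookup (f i) t)"
  by (simp add: frag_extend_superset[OF assms] lookup_frag_sum)

lemma frag_extend_fun_diff:
  "frag_extend (\<lambda>r. f r - g r) a = frag_extend f a - frag_extend g a"
  by (rule poly_mapping_eqI)
     (simp add: frag_extend_def lookup_frag_sum lookup_minus sum_subtractf right_diff_distrib)

lemma frag_extend_fun_0: "frag_extend (\<lambda>r. 0) a = 0"
  by (simp add: frag_extend_def)

lemma bilinear_extend_of [simp]: "bilinear_extend f (frag_of r) (frag_of s) = f r s"
  by (simp add: bilinear_extend_def)

lemma bilinear_extend_0 [simp]: "bilinear_extend f 0 b = 0" "bilinear_extend f a 0 = 0"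
  by (simp_all add: bilinear_extend_def frag_extend_fun_0)

lemma bilinear_extend_diff: "bilinear_extend f (a - a') b = bilinear_extend f a b - bilinear_extend f a' b"
   "bilinear_extend f a (b - b') = bilinear_extend f a b - bilinear_extend f a b'"
  by (simp_all add: bilinear_extend_def frag_extend_diff frag_extend_fun_diff)

lemma bilinear_extend_minus: "bilinear_extend f (- a') b = - bilinear_extend f a' b"
   "bilinear_extend f a (- b') = - bilinear_extend f a b'"
  using bilinear_extend_diff(1)[of f 0] bilinear_extend_diff(2)[of f a 0] by simp_all

lemma bilinear_extend_add: "bilinear_extend f (a + a') b = bilinear_extend f a b + bilinear_extend f a' b"
   "bilinear_extend f a (b + b') = bilinear_extend f a b + bilinear_extend f a b'"
  using bilinear_extend_diff(1)[of f a "-a'"] bilinear_extend_diff(2)[of f a b "-b'"] by (simp_all add: bilinear_extend_minus)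

lemma bilinear_extend_keys:
  assumes "Poly_Mapping.keys a \<subseteq> S" "Poly_Mapping.keys b \<subseteq> T"
    "\<And>r s. r \<in> S \<Longrightarrow> s \<in> T \<Longrightarrow> Poly_Mapping.keys (f r s) \<subseteq> U"
  shows "Poly_Mapping.keys (bilinear_extend f a b) \<subseteq> U"
proof -
  have "Poly_Mapping.keys (frag_extend (f r) b) \<subseteq> U" if "r \<in> S" for r
    using keys_frag_extend[of "f r" b] assms that by blast
  then show ?thesis unfolding bilinear_extend_def
    using keys_frag_extend[of "\<lambda>r. frag_extend (f r) b" a] assms(1) by blast
qed

lemma bilinear_extend_assoc:
  assumes "Poly_Mapping.keys a \<subseteq> S" "Poly_Mapping.keys b \<subseteq> T" "Poly_Mapping.keys c \<subseteq> U"
    "\<And>r s t. r \<in> S \<Longrightarrow> s \<in> T \<Longrightarrow> t \<in> U \<Longrightarrow>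
       bilinear_extend g (f r s) (frag_of t) = bilinear_extend g' (frag_of r) (f' s t)"
  shows "bilinear_extend g (bilinear_extend f a b) c = bilinear_extend g' a (bilinear_extend f' b c)"
  using assms(1)
proof (induction a rule: frag_induction)
  case (one r)
  show ?case using assms(2)
  proof (induction b rule: frag_induction)
    case (one s)
    show ?case using assms(3)
    proof (induction c rule: frag_induction)
      case (one t) then show ?case using assms(4) \<open>r \<in> S\<close> \<open>s \<in> T\<close> by simp
    qed (auto simp: bilinear_extend_diff)
  qed (auto simp: bilinear_extend_diff)
qed (auto simp: bilinear_extend_diff)

lemma form_superset:
  assumes "finite S" "Poly_Mapping.keys c \<subseteq> S"
  shows "form c d = (\<Sum>s\<in>S. Poly_Mapping.lookup c s * Poly_Mapping.lookup d s)"
  unfolding form_def using assms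
  by (intro sum.mono_neutral_left) (auto simp: in_keys_iff)

lemma form_of [simp]: "form c (frag_of t) = Poly_Mapping.lookup c t" "form (frag_of t) c = Poly_Mapping.lookup c t"
  by (auto simp: form_def in_keys_iff if_distrib sum.delta cong: if_cong)

lemma bilinear_extend_unit:
  assumes "Poly_Mapping.keys a \<subseteq> S"
  shows "(\<And>r. r \<in> S \<Longrightarrow> f u r = frag_of r) \<Longrightarrow> bilinear_extend f (frag_of u) a = a"
    "(\<And>r. r \<in> S \<Longrightarrow> f r u = frag_of r) \<Longrightarrow> bilinear_extend f a (frag_of u) = a"
  using assms by (induction a rule: frag_induction) (auto simp: bilinear_extend_diff)

lemma fusion_ringI:
  assumes B: "fus_unit R \<in> fus_basis R"
   and m: "fus_mult R = bilinear_extend f"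
   and k: "\<And>r s. r \<in> fus_basis R \<Longrightarrow> s \<in> fus_basis R \<Longrightarrow> Poly_Mapping.keys (f r s) \<subseteq> fus_basis R"
   and u: "\<And>r. r \<in> fus_basis R \<Longrightarrow> f (fus_unit R) r = frag_of r"
      "\<And>r. r \<in> fus_basis R \<Longrightarrow> f r (fus_unit R) = frag_of r"
   and a: "\<And>r s t. r \<in> fus_basis R \<Longrightarrow> s \<in> fus_basis R \<Longrightarrow> t \<in> fus_basis R \<Longrightarrow>
       bilinear_extend f (f r s) (frag_of t) = bilinear_extend f (frag_of r) (f s t)"
  shows "ring (fusion_ring R)"
proof (rule ringI)
  show "abelian_group (fusion_ring R)"
  proof (rule abelian_groupI)
    fix x assume x: "x \<in> carrier (fusion_ring R)"
    show "\<exists>y\<in>carrier (fusion_ring R). y \<oplus>\<^bsub>fusion_ring R\<^esub> x = \<zero>\<^bsub>fusion_ring R\<^esub>"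
      by (rule bexI[of _ "-x"]) (use x in \<open>auto simp: fusion_ring_def\<close>)
  next
    fix x y assume "x \<in> carrier (fusion_ring R)" "y \<in> carrier (fusion_ring R)"
    then show "x \<oplus>\<^bsub>fusion_ring R\<^esub> y \<in> carrier (fusion_ring R)"
      by (simp add: fusion_ring_def order_trans[OF Poly_Mapping.keys_add])
  qed (simp_all add: fusion_ring_def algebra_simps)
  show "Group.monoid (fusion_ring R)"
  proof (rule monoidI)
    fix x y assume "x \<in> carrier (fusion_ring R)" "y \<in> carrier (fusion_ring R)"
    then show "x \<otimes>\<^bsub>fusion_ring R\<^esub> y \<in> carrier (fusion_ring R)"
      using bilinear_extend_keys[of x "fus_basis R" y "fus_basis R" f "fus_basis R", OF _ _ k] by (simp add: fusion_ring_def m)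
  next
    fix x y z assume "x \<in> carrier (fusion_ring R)" "y \<in> carrier (fusion_ring R)" "z \<in> carrier (fusion_ring R)"
    then show "x \<otimes>\<^bsub>fusion_ring R\<^esub> y \<otimes>\<^bsub>fusion_ring R\<^esub> z = x \<otimes>\<^bsub>fusion_ring R\<^esub> (y \<otimes>\<^bsub>fusion_ring R\<^esub> z)"
      using bilinear_extend_assoc[of x "fus_basis R" y "fus_basis R" z "fus_basis R" f f f f, OF _ _ _ a] by (simp add: fusion_ring_def m)
  next
    show "\<one>\<^bsub>fusion_ring R\<^esub> \<in> carrier (fusion_ring R)" using B by (simp add: fusion_ring_def)
  next
    fix x assume x: "x \<in> carrier (fusion_ring R)"
    show "\<one>\<^bsub>fusion_ring R\<^esub> \<otimes>\<^bsub>fusion_ring R\<^esub> x = x"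
      using x bilinear_extend_unit(1)[of x "fus_basis R" f "fus_unit R", OF _ u(1)] by (simp add: fusion_ring_def m)
    show "x \<otimes>\<^bsub>fusion_ring R\<^esub> \<one>\<^bsub>fusion_ring R\<^esub> = x"
      using x bilinear_extend_unit(2)[of x "fus_basis R" f "fus_unit R", OF _ u(2)] by (simp add: fusion_ring_def m)
  qed
qed (auto simp: fusion_ring_def m bilinear_extend_add)

lemma fusion_ruleD:
  assumes "fusion_rule R"
  shows "Poly_Mapping.keys a \<subseteq> fus_basis R \<Longrightarrow> Poly_Mapping.keys b \<subseteq> fus_basis R \<Longrightarrow> Poly_Mapping.keys (fus_mult R a b) \<subseteq> fus_basis R"
   "a \<in> ZZ (fus_basis R) \<Longrightarrow> fus_mult R (frag_of (fus_unit R)) a = a"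
   "a \<in> ZZ (fus_basis R) \<Longrightarrow> fus_mult R a (frag_of (fus_unit R)) = a"
   "a \<in> ZZ (fus_basis R) \<Longrightarrow> b \<in> ZZ (fus_basis R) \<Longrightarrow> c \<in> ZZ (fus_basis R) \<Longrightarrow> 
     fus_mult R (fus_mult R a b) c = fus_mult R a (fus_mult R b c)"
  "fus_unit R \<in> fus_basis R"
proof -
  have r: "ring (fusion_ring R)" and "fus_unit R \<in> fus_basis R" using assms by (auto simp: fusion_rule_def)
  then show "fus_unit R \<in> fus_basis R" by simp
  interpret ring "fusion_ring R" by (rule r)
  show "Poly_Mapping.keys a \<subseteq> fus_basis R \<Longrightarrow> Poly_Mapping.keys b \<subseteq> fus_basis R \<Longrightarrow> Poly_Mapping.keys (fus_mult R a b) \<subseteq> fus_basis R"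
    using m_closed[of a b] by (simp add: fusion_ring_def)
  show  "a \<in> ZZ (fus_basis R) \<Longrightarrow> fus_mult R (frag_of (fus_unit R)) a = a"
   "a \<in> ZZ (fus_basis R) \<Longrightarrow> fus_mult R a (frag_of (fus_unit R)) = a"
   "a \<in> ZZ (fus_basis R) \<Longrightarrow> b \<in> ZZ (fus_basis R) \<Longrightarrow> c \<in> ZZ (fus_basis R) \<Longrightarrow> 
     fus_mult R (fus_mult R a b) c = fus_mult R a (fus_mult R b c)"
    using l_one[of a] r_one[of a] m_assoc[of a b c] by (simp_all add: fusion_ring_def)
qed

lemma fib_assoc: "bilinear_extend fib_mult (fib_mult r s) (frag_of t) = bilinear_extend fib_mult (frag_of r) (fib_mult s t)"
  by (cases r; cases s; cases t) (auto simp: bilinear_extend_add algebra_simps)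

lemma fusion_rule_Fib: "fusion_rule Fib"
proof -
  have "ring (fusion_ring Fib)"
  proof (rule fusion_ringI[where f = fib_mult])
    fix r :: fib show "fib_mult r (fus_unit Fib) = frag_of r" by (cases r) (auto simp: Fib_def)
  qed (auto simp: Fib_def fib_assoc)
  moreover have "nonneg (fib_mult r s)" for r s
    by (cases r; cases s) (auto simp: nonneg_def lookup_add)
  moreover have "form (fib_mult r s) (frag_of t) = form (frag_of s) (fib_mult r t)" for r s t
    by (cases r; cases s; cases t) (auto simp: lookup_add)
  ultimately show ?thesis by (simp add: fusion_rule_def Fib_def)
qed


lemma fus_mult_lin:
  assumes "fusion_rule R" "a \<in> ZZ (fus_basis R)" "a' \<in> ZZ (fus_basis R)" "b \<in> ZZ (fus_basis R)"
  shows "fus_mult R (a + a') b = fus_mult R a b + fus_mult R a' b"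
    "fus_mult R b (a + a') = fus_mult R b a + fus_mult R b a'"
proof -
  interpret ring "fusion_ring R" using assms by (simp add: fusion_rule_def)
  show "fus_mult R (a + a') b = fus_mult R a b + fus_mult R a' b"
    "fus_mult R b (a + a') = fus_mult R b a + fus_mult R b a'"
    using l_distr[of a a' b] r_distr[of a a' b] assms by (simp_all add: fusion_ring_def)
qed

lemma fus_mult_lin_diff:
  assumes "fusion_rule R" "a \<in> ZZ (fus_basis R)" "a' \<in> ZZ (fus_basis R)" "b \<in> ZZ (fus_basis R)"
  shows "fus_mult R (a - a') b = fus_mult R a b - fus_mult R a' b"
    "fus_mult R b (a - a') = fus_mult R b a - fus_mult R b a'"
proof -
  have "a - a' \<in> ZZ (fus_basis R)" using assms keys_diff[of a a'] by auto
  then show "fus_mult R (a - a') b = fus_mult R a b - fus_mult R a' b"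
    "fus_mult R b (a - a') = fus_mult R b a - fus_mult R b a'"
    using fus_mult_lin[of R "a - a'" a' b] assms by (simp_all add: algebra_simps)
qed

lemma fus_mult_0:
  assumes "fusion_rule R" "b \<in> ZZ (fus_basis R)"
  shows "fus_mult R 0 b = 0" "fus_mult R b 0 = 0"
  using fus_mult_lin[of R 0 0 b] assms by simp_all

lemma fus_mult_extend:
  assumes R: "fusion_rule R" and a: "Poly_Mapping.keys a \<subseteq> fus_basis R" and b: "Poly_Mapping.keys b \<subseteq> fus_basis R"
  shows "fus_mult R a b = bilinear_extend (\<lambda>r s. fus_mult R (frag_of r) (frag_of s)) a b"
proof -
  let ?B = "bilinear_extend (\<lambda>r s. fus_mult R (frag_of r) (frag_of s))"
  have kd: "Poly_Mapping.keys (x - y) \<subseteq> fus_basis R" if "Poly_Mapping.keys x \<subseteq> fus_basis R" "Poly_Mapping.keys y \<subseteq> fus_basis R" for x y :: "'a \<Rightarrow>\<^sub>0 int"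
    using keys_diff[of x y] that by blast
  have 1: "Poly_Mapping.keys b \<subseteq> fus_basis R \<and> fus_mult R (frag_of r) b = ?B (frag_of r) b" if r: "r \<in> fus_basis R" for r
    using b
  proof (induction b rule: frag_induction)
    case (diff x y)
    then show ?case using r kd[of x y] by (simp add: fus_mult_lin_diff R bilinear_extend_diff)
  qed (use r in \<open>simp_all add: fus_mult_0 R\<close>)
  have "Poly_Mapping.keys a \<subseteq> fus_basis R \<and> fus_mult R a b = ?B a b"
    using a
  proof (induction a rule: frag_induction)
    case (diff x y)
    then show ?case using b kd[of x y] by (simp add: fus_mult_lin_diff R bilinear_extend_diff)
  qed (use b 1 in \<open>simp_all add: fus_mult_0 R\<close>)
  then show ?thesis by simp
qed

lemma lookup_fus_mult_left:
  assumes R: "fusion_rule R" and a: "Poly_Mapping.keys a \<subseteq> fus_basis R" and b: "t \<in> fus_basis R"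
  shows "Poly_Mapping.lookup (fus_mult R a (frag_of t)) v = 
   (\<Sum>x\<in>Poly_Mapping.keys a. Poly_Mapping.lookup a x * Poly_Mapping.lookup (fus_mult R (frag_of x) (frag_of t)) v)"
  using fus_mult_extend[OF R a, of "frag_of t"] b
  by (simp add: bilinear_extend_def lookup_frag_extend[where S = "Poly_Mapping.keys a"])

lemma lookup_fus_mult_right:
  assumes R: "fusion_rule R" and a: "Poly_Mapping.keys a \<subseteq> fus_basis R" and b: "t \<in> fus_basis R"
  shows "Poly_Mapping.lookup (fus_mult R (frag_of t) a) v = 
   (\<Sum>x\<in>Poly_Mapping.keys a. Poly_Mapping.lookup a x * Poly_Mapping.lookup (fus_mult R (frag_of t) (frag_of x)) v)"
  using fus_mult_extend[OF R _ a, of "frag_of t"] b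
  by (simp add: bilinear_extend_def lookup_frag_extend[where S = "Poly_Mapping.keys a"])

definition "prod_mult I R r s = 
         (\<Sum>t\<in>(\<Pi>\<^sub>E i\<in>I. Poly_Mapping.keys (fus_mult (R i) (frag_of (r i)) (frag_of (s i)))).
           frag_cmul (\<Prod>i\<in>I. Poly_Mapping.lookup (fus_mult (R i) (frag_of (r i)) (frag_of (s i))) (t i)) (frag_of t))"

lemma lookup_prod_mult:
  assumes "finite I"
  shows "Poly_Mapping.lookup (prod_mult I R r s) t = 
    (if t \<in> extensional I then (\<Prod>i\<in>I. Poly_Mapping.lookup (fus_mult (R i) (frag_of (r i)) (frag_of (s i))) (t i)) else 0)"
proof -
  let ?K = "(\<Pi>\<^sub>E i\<in>I. Poly_Mapping.keys (fus_mult (R i) (frag_of (r i)) (frag_of (s i))))"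
  have fin: "finite ?K" using assms by (intro finite_PiE) auto
  have "Poly_Mapping.lookup (prod_mult I R r s) t = (if t \<in> ?K then (\<Prod>i\<in>I. Poly_Mapping.lookup (fus_mult (R i) (frag_of (r i)) (frag_of (s i))) (t i)) else 0)"
  proof -
    have "Poly_Mapping.lookup (prod_mult I R r s) t = (\<Sum>t'\<in>?K. if t = t' then (\<Prod>i\<in>I. Poly_Mapping.lookup (fus_mult (R i) (frag_of (r i)) (frag_of (s i))) (t i)) else 0)"
      unfolding prod_mult_def lookup_frag_sum by (rule sum.cong) auto
    then show ?thesis using fin by (simp only: sum.delta' sum.delta)
  qed
  also have "\<dots> = (if t \<in> extensional I then (\<Prod>i\<in>I. Poly_Mapping.lookup (fus_mult (R i) (frag_of (r i)) (frag_of (s i))) (t i)) else 0)"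
  proof (cases "t \<in> ?K")
    case True then show ?thesis by (simp add: PiE_iff)
  next
    case False
    then have "t \<notin> extensional I \<or> (\<exists>i\<in>I. Poly_Mapping.lookup (fus_mult (R i) (frag_of (r i)) (frag_of (s i))) (t i) = 0)"
      by (simp add: PiE_iff in_keys_iff) blast
    then show ?thesis using False assms by (metis (mono_tags, lifting) prod_zero)
  qed
  finally show ?thesis .
qed

lemma keys_prod_mult:
  assumes "finite I"
  shows "Poly_Mapping.keys (prod_mult I R r s) = (\<Pi>\<^sub>E i\<in>I. Poly_Mapping.keys (fus_mult (R i) (frag_of (r i)) (frag_of (s i))))"
proof -
  have "t \<in> Poly_Mapping.keys (prod_mult I R r s) \<longleftrightarrow> t \<in> (\<Pi>\<^sub>E i\<in>I. Poly_Mapping.keys (fus_mult (R i) (frag_of (r i)) (frag_of (s i))))" for t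
    unfolding in_keys_iff lookup_prod_mult[OF assms] PiE_iff using assms by (simp add: prod_zero_iff)
  then show ?thesis by blast
qed

lemma prod_mult_assoc:
  assumes I: "finite I" and R: "\<And>i. i \<in> I \<Longrightarrow> fusion_rule (R i)"
   and r: "r \<in> (\<Pi>\<^sub>E i\<in>I. fus_basis (R i))" and s: "s \<in> (\<Pi>\<^sub>E i\<in>I. fus_basis (R i))" and t: "t \<in> (\<Pi>\<^sub>E i\<in>I. fus_basis (R i))"
  shows "bilinear_extend (prod_mult I R) (prod_mult I R r s) (frag_of t) = bilinear_extend (prod_mult I R) (frag_of r) (prod_mult I R s t)"
proof (rule poly_mapping_eqI)
  fix v
  let ?c = "\<lambda>i a b x. Poly_Mapping.lookup (fus_mult (R i) (frag_of a) (frag_of b)) x"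
  let ?K = "\<lambda>r s i. Poly_Mapping.keys (fus_mult (R i) (frag_of (r i)) (frag_of (s i)))"
  have K: "?K r s i \<subseteq> fus_basis (R i)" "?K s t i \<subseteq> fus_basis (R i)" if "i \<in> I" for i
    using fusion_ruleD(1)[OF R[OF that]] r s t that by (auto simp: PiE_iff)
  have "Poly_Mapping.lookup (bilinear_extend (prod_mult I R) (prod_mult I R r s) (frag_of t)) v =
    (\<Sum>u\<in>PiE I (?K r s). Poly_Mapping.lookup (prod_mult I R r s) u * Poly_Mapping.lookup (prod_mult I R u t) v)"
    using I by (simp add: bilinear_extend_def lookup_frag_extend[where S = "PiE I (?K r s)"] keys_prod_mult finite_PiE)
  also have "\<dots> = (if v \<in> extensional I then (\<Sum>u\<in>PiE I (?K r s). \<Prod>i\<in>I. ?c i (r i) (s i) (u i) * ?c i (u i) (t i) (v i)) else 0)"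
    using I by (auto simp: lookup_prod_mult prod.distrib PiE_def intro!: sum.cong)
  also have "\<dots> = (if v \<in> extensional I then (\<Prod>i\<in>I. \<Sum>x\<in>?K r s i. ?c i (r i) (s i) x * ?c i x (t i) (v i)) else 0)"
    using I by (simp add: prod_sum_PiE)
  also have "\<dots> = (if v \<in> extensional I then (\<Prod>i\<in>I. Poly_Mapping.lookup (fus_mult (R i) (fus_mult (R i) (frag_of (r i)) (frag_of (s i))) (frag_of (t i))) (v i)) else 0)"
    using K t by (simp add: lookup_fus_mult_left R PiE_iff)
  also have "\<dots> = (if v \<in> extensional I then (\<Prod>i\<in>I. Poly_Mapping.lookup (fus_mult (R i) (frag_of (r i)) (fus_mult (R i) (frag_of (s i)) (frag_of (t i)))) (v i)) else 0)"
    using r s t by (simp add: fusion_ruleD(4) R PiE_iff)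
  also have "\<dots> = (if v \<in> extensional I then (\<Prod>i\<in>I. \<Sum>x\<in>?K s t i. ?c i (s i) (t i) x * ?c i (r i) x (v i)) else 0)"
    using K r by (simp add: lookup_fus_mult_right R PiE_iff)
  also have "\<dots> = (if v \<in> extensional I then (\<Sum>u\<in>PiE I (?K s t). \<Prod>i\<in>I. ?c i (s i) (t i) (u i) * ?c i (r i) (u i) (v i)) else 0)"
    using I by (simp add: prod_sum_PiE)
  also have "\<dots> = (\<Sum>u\<in>PiE I (?K s t). Poly_Mapping.lookup (prod_mult I R s t) u * Poly_Mapping.lookup (prod_mult I R r u) v)"
    using I by (auto simp: lookup_prod_mult prod.distrib PiE_def intro!: sum.cong)
  also have "\<dots> = Poly_Mapping.lookup (bilinear_extend (prod_mult I R) (frag_of r) (prod_mult I R s t)) v"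
    using I by (simp add: bilinear_extend_def lookup_frag_extend[where S = "PiE I (?K s t)"] keys_prod_mult finite_PiE)
  finally show "Poly_Mapping.lookup (bilinear_extend (prod_mult I R) (prod_mult I R r s) (frag_of t)) v = \<dots>" .
qed

lemma fusion_product_simps:
  "fus_basis (fusion_product I R) = (\<Pi>\<^sub>E i\<in>I. fus_basis (R i))"
  "fus_mult (fusion_product I R) = bilinear_extend (prod_mult I R)"
  "fus_unit (fusion_product I R) = (\<lambda>i\<in>I. fus_unit (R i))"
  "fus_dual (fusion_product I R) r = (\<lambda>i\<in>I. fus_dual (R i) (r i))"
  by (simp_all add: fusion_product_def Let_def prod_mult_def[abs_def])

lemma prod_mult_unit:
  assumes I: "finite I" and R: "\<And>i. i \<in> I \<Longrightarrow> fusion_rule (R i)" and r: "r \<in> (\<Pi>\<^sub>E i\<in>I. fus_basis (R i))"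
  shows "prod_mult I R (\<lambda>i\<in>I. fus_unit (R i)) r = frag_of r" "prod_mult I R r (\<lambda>i\<in>I. fus_unit (R i)) = frag_of r"
proof -
  have *: "r = t" if "\<And>i. i \<in> I \<Longrightarrow> t i = r i" "t \<in> extensional I" for t
    using that r by (metis PiE_iff extensionalityI)
  have 1: "fus_mult (R i) (frag_of (fus_unit (R i))) (frag_of (r i)) = frag_of (r i)"
     "fus_mult (R i) (frag_of (r i)) (frag_of (fus_unit (R i))) = frag_of (r i)" if "i \<in> I" for i
    using fusion_ruleD(2,3)[OF R[OF that], of "frag_of (r i)"] r that by (auto simp: PiE_iff)
  have 2: "(if t \<in> extensional I then \<Prod>i\<in>I. Poly_Mapping.lookup (frag_of (r i)) (t i) else 0) = 
     Poly_Mapping.lookup (frag_of r) t" for t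
  proof (cases "t = r")
    case True then show ?thesis using r by (simp add: PiE_iff)
  next
    case False
    then have "t \<notin> extensional I \<or> (\<exists>i\<in>I. t i \<noteq> r i)" using * by metis
    then show ?thesis using False I by (auto intro!: prod_zero)
  qed
  show "prod_mult I R (\<lambda>i\<in>I. fus_unit (R i)) r = frag_of r" "prod_mult I R r (\<lambda>i\<in>I. fus_unit (R i)) = frag_of r"
    by (rule poly_mapping_eqI, subst 2[symmetric], simp add: lookup_prod_mult[OF I] 1 del: lookup_frag_of)+
qed

lemma fusion_ruleD2:
  assumes "fusion_rule R"
  shows "r \<in> fus_basis R \<Longrightarrow> s \<in> fus_basis R \<Longrightarrow> 0 \<le> Poly_Mapping.lookup (fus_mult R (frag_of r) (frag_of s)) t"
   "r \<in> fus_basis R \<Longrightarrow> fus_dual R r \<in> fus_basis R" "r \<in> fus_basis R \<Longrightarrow> fus_dual R (fus_dual R r) = r"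
   "r \<in> fus_basis R \<Longrightarrow> s \<in> fus_basis R \<Longrightarrow> t \<in> fus_basis R \<Longrightarrow>
        Poly_Mapping.lookup (fus_mult R (frag_of r) (frag_of s)) t =
        Poly_Mapping.lookup (fus_mult R (frag_of (fus_dual R r)) (frag_of t)) s"
  using assms unfolding fusion_rule_def nonneg_def form_of by blast+

lemma fusion_rule_product:
  assumes I: "finite I" and R: "\<And>i. i \<in> I \<Longrightarrow> fusion_rule (R i)"
  shows "fusion_rule (fusion_product I R)"
  unfolding fusion_rule_def
proof (intro conjI ballI)
  let ?P = "fusion_product I R"
  show u: "fus_unit ?P \<in> fus_basis ?P"
    using R fusion_ruleD(5) by (fastforce simp: fusion_product_simps)
  show "ring (fusion_ring ?P)"
  proof (rule fusion_ringI[where f = "prod_mult I R", OF u])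
    fix r s assume rs: "r \<in> fus_basis ?P" "s \<in> fus_basis ?P"
    have "Poly_Mapping.keys (fus_mult (R i) (frag_of (r i)) (frag_of (s i))) \<subseteq> fus_basis (R i)" if "i \<in> I" for i
      using fusion_ruleD(1)[OF R[OF that]] rs that by (auto simp: fusion_product_simps PiE_iff)
    then show "Poly_Mapping.keys (prod_mult I R r s) \<subseteq> fus_basis ?P"
      by (auto simp: keys_prod_mult[OF I] fusion_product_simps intro!: PiE_mono)
  qed (auto simp: fusion_product_simps prod_mult_assoc[OF I R] prod_mult_unit[OF I R])
next
  fix r s assume rs: "r \<in> fus_basis (fusion_product I R)" "s \<in> fus_basis (fusion_product I R)"
  then show "nonneg (fus_mult (fusion_product I R) (frag_of r) (frag_of s))"
    using fusion_ruleD2(1)[OF R] by (auto simp: fusion_product_simps nonneg_def lookup_prod_mult[OF I] PiE_iff intro!: prod_nonneg)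
next
  fix r assume r: "r \<in> fus_basis (fusion_product I R)"
  have D: "fus_dual (R i) (r i) \<in> fus_basis (R i)" "fus_dual (R i) (fus_dual (R i) (r i)) = r i" if "i \<in> I" for i
    using that r fusion_ruleD2(2,3)[OF R[OF that]] by (simp_all add: fusion_product_simps PiE_iff)
  show "fus_dual (fusion_product I R) r \<in> fus_basis (fusion_product I R)"
    using D by (auto simp: fusion_product_simps)
  show "fus_dual (fusion_product I R) (fus_dual (fusion_product I R) r) = r"
    by (rule extensionalityI[of _ I]) (use r D in \<open>auto simp: fusion_product_simps PiE_iff\<close>)
  fix s t assume s: "s \<in> fus_basis (fusion_product I R)" and t: "t \<in> fus_basis (fusion_product I R)"
  have "Poly_Mapping.lookup (fus_mult (R i) (frag_of (r i)) (frag_of (s i))) (t i) =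
    Poly_Mapping.lookup (fus_mult (R i) (frag_of (fus_dual (R i) (r i))) (frag_of (t i))) (s i)" if "i \<in> I" for i
    by (rule fusion_ruleD2(4)[OF R[OF that]]) (use that r s t in \<open>simp_all add: fusion_product_simps PiE_iff\<close>)
  then show "form (fus_mult (fusion_product I R) (frag_of r) (frag_of s)) (frag_of t) =
       form (frag_of s) (fus_mult (fusion_product I R) (frag_of (fus_dual (fusion_product I R) r)) (frag_of t))"
    using s t by (simp add: fusion_product_simps lookup_prod_mult[OF I] PiE_iff)
qed

lemma fusion_rule_Fib_power: "fusion_rule (Fib_power l)"
  by (simp add: Fib_power_def fusion_rule_product fusion_rule_Fib)

declare One_nat_def [simp del] PiE_UNIV_domain [simp del]

abbreviation Fib_prod :: "nat \<Rightarrow> (nat \<Rightarrow> fib) \<Rightarrow> (nat \<Rightarrow> fib) \<Rightarrow> ((nat \<Rightarrow> fib) \<Rightarrow>\<^sub>0 int)" where "Fib_prod l \<equiv> prod_mult {1..l} (\<lambda>_. Fib)"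

lemma Fib_power_simps [simp]: "fus_basis (Fib_power l) = (\<Pi>\<^sub>E i\<in>{1..l}. UNIV)"
  "fus_mult (Fib_power l) = bilinear_extend (Fib_prod l)"
  "fus_unit (Fib_power l) = (\<lambda>i\<in>{1..l}. Fib1)"
  "fus_dual (Fib_power l) r = (\<lambda>i\<in>{1..l}. r i)"
  by (simp_all add: Fib_power_def fusion_product_simps) (simp_all add: Fib_def)

lemma lookup_Fib_prod: "Poly_Mapping.lookup (Fib_prod l r s) t = 
    (if t \<in> extensional {1..l} then (\<Prod>i\<in>{1..l}. Poly_Mapping.lookup (fib_mult (r i) (s i)) (t i)) else 0)"
proof -
  have "fus_mult Fib (frag_of a) (frag_of b) = fib_mult a b" for a b by (simp add: Fib_def)
  then show ?thesis by (simp add: lookup_prod_mult)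
qed

lemma Fib_prod_comm: "Fib_prod l r s = Fib_prod l s r"
proof -
  have "fib_mult a b = fib_mult b a" for a b by (cases a; cases b) auto
  then show ?thesis by (intro poly_mapping_eqI) (simp only: lookup_Fib_prod)
qed

lemma frag_extend_sum': "frag_extend f (\<Sum>i\<in>I. g i) = (\<Sum>i\<in>I. frag_extend f (g i))"
  by (induction I rule: infinite_finite_induct) (auto simp: frag_extend_add)

lemma frag_extend_fun_sum: "frag_extend (\<lambda>r. \<Sum>i\<in>I. g i r) a = (\<Sum>i\<in>I. frag_extend (g i) a)"
  unfolding frag_extend_def by (subst sum.swap) (simp add: frag_cmul_sum)

lemma frag_extend_fun_cmul: "frag_extend (\<lambda>r. frag_cmul c (g r)) a = frag_cmul c (frag_extend g a)"
  by (simp add: frag_extend_def frag_cmul_sum mult.commute)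

lemma bilinear_extend_sum: "bilinear_extend f (\<Sum>i\<in>I. a i) b = (\<Sum>i\<in>I. bilinear_extend f (a i) b)"
   "bilinear_extend f b (\<Sum>i\<in>I. a i) = (\<Sum>i\<in>I. bilinear_extend f b (a i))"
  by (simp_all add: bilinear_extend_def frag_extend_sum' frag_extend_fun_sum)

lemma bilinear_extend_cmul: "bilinear_extend f (frag_cmul c a) b = frag_cmul c (bilinear_extend f a b)"
   "bilinear_extend f a (frag_cmul c b) = frag_cmul c (bilinear_extend f a b)"
  by (simp_all add: bilinear_extend_def frag_extend_cmul frag_extend_fun_cmul)

lemma bilinear_extend_comm:
  assumes "\<And>r s. f r s = f s r" shows "bilinear_extend f a b = bilinear_extend f b a"
proof -
  have 1: "bilinear_extend f a b = bilinear_extend f b a" if "a = frag_of r" for a b r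
    using subset_UNIV[of "Poly_Mapping.keys b"] unfolding that
    by (induction b rule: frag_induction) (auto simp: bilinear_extend_diff assms)
  show ?thesis
    using subset_UNIV[of "Poly_Mapping.keys a"]
    by (induction a rule: frag_induction) (auto simp: bilinear_extend_diff 1)
qed

lemma cring_Fib_power: "cring (fusion_ring (Fib_power k))"
proof -
  interpret ring "fusion_ring (Fib_power k)" using fusion_rule_Fib_power by (simp add: fusion_rule_def)
  show ?thesis
    by unfold_locales (simp add: fusion_ring_def bilinear_extend_comm[of "Fib_prod k", OF Fib_prod_comm])
qed

lemma Fib_power_ring_simps: "x \<in> carrier (fusion_ring (Fib_power k)) \<longleftrightarrow> Poly_Mapping.keys x \<subseteq> (\<Pi>\<^sub>E i\<in>{1..k}. UNIV)" "x \<otimes>\<^bsub>fusion_ring (Fib_power k)\<^esub> y = bilinear_extend (Fib_prod k) x y" "x \<oplus>\<^bsub>fusion_ring (Fib_power k)\<^esub> y = x + y"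
  "\<one>\<^bsub>fusion_ring (Fib_power k)\<^esub> = frag_of (\<lambda>i\<in>{1..k}. Fib1)"
  by (simp_all add: fusion_ring_def)

lemma Fib_gen_basis: "Fib_gen k j \<in> (\<Pi>\<^sub>E i\<in>{1..k}. UNIV)"
  by (simp add: Fib_gen_def)

lemma Fib_gen_square:
  assumes j: "j \<in> {1..k}"
  shows "Fib_prod k (Fib_gen k j) (Fib_gen k j) = frag_of (\<lambda>i\<in>{1..k}. Fib1) + frag_of (Fib_gen k j)"
proof (rule poly_mapping_eqI)
  fix t
  let ?S = "{1..k} - {j}"
  have E: "t = (\<lambda>i\<in>{1..k}. if i = j then a else Fib1) \<longleftrightarrow> t \<in> extensional {1..k} \<and> t j = a \<and> (\<forall>i\<in>?S. t i = Fib1)" for a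
    using j by (auto simp: restrict_def extensional_def fun_eq_iff)
  have E1: "t = (\<lambda>i\<in>{1..k}. Fib1) \<longleftrightarrow> t \<in> extensional {1..k} \<and> t j = Fib1 \<and> (\<forall>i\<in>?S. t i = Fib1)"
    using E[of Fib1] by (simp cong: if_cong)
  have I: "{1..k} = insert j ?S" using j by auto
  have P: "(\<Prod>i\<in>?S. Poly_Mapping.lookup (fib_mult (Fib_gen k j i) (Fib_gen k j i)) (t i)) = (if \<forall>i\<in>?S. t i = Fib1 then 1 else 0)"
  proof (cases "\<forall>i\<in>?S. t i = Fib1")
    case True then show ?thesis by (auto simp: Fib_gen_def intro!: prod.neutral)
  next
    case False then show ?thesis by (auto simp: Fib_gen_def intro!: prod_zero)
  qed
  have "(\<Prod>i\<in>{1..k}. Poly_Mapping.lookup (fib_mult (Fib_gen k j i) (Fib_gen k j i)) (t i)) =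
     Poly_Mapping.lookup (fib_mult FibX FibX) (t j) * (if \<forall>i\<in>?S. t i = Fib1 then 1 else 0)"
    unfolding P[symmetric] using j by (subst I, subst prod.insert) (auto simp: Fib_gen_def)
  also have "Poly_Mapping.lookup (fib_mult FibX FibX) (t j) = 1" by (cases "t j") (auto simp: lookup_add)
  finally show "Poly_Mapping.lookup (Fib_prod k (Fib_gen k j) (Fib_gen k j)) t = Poly_Mapping.lookup (frag_of (\<lambda>i\<in>{1..k}. Fib1) + frag_of (Fib_gen k j)) t"
    unfolding lookup_Fib_prod lookup_add lookup_frag_of Fib_gen_def E E1
    by (cases "t j") auto
qed

lemma UNIV_fib: "(UNIV :: fib set) = {Fib1, FibX}"
  by (auto intro: fib.exhaust)

instance fib :: finite
  by standard (simp add: UNIV_fib)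

lemma finprod_sum_Fib_power:
  assumes A: "finite A" and h: "\<And>i y. i \<in> A \<Longrightarrow> h i y \<in> carrier (fusion_ring (Fib_power k))"
  shows "(\<Sum>t\<in>(\<Pi>\<^sub>E i\<in>A. UNIV). frag_cmul (\<Prod>i\<in>A. c i (t i)) (\<Otimes>\<^bsub>fusion_ring (Fib_power k)\<^esub> i\<in>A. h i (t i :: fib))) =
    (\<Otimes>\<^bsub>fusion_ring (Fib_power k)\<^esub> i\<in>A. \<Sum>y\<in>UNIV. frag_cmul (c i y) (h i y))"
  using A h
proof (induction A rule: finite_induct)
  interpret cring "fusion_ring (Fib_power k)" by (rule cring_Fib_power)
  case empty show ?case by simp
next
  interpret cring "fusion_ring (Fib_power k)" by (rule cring_Fib_power)
  have sc: "(\<Sum>y\<in>S. frag_cmul (c i y) (h y)) \<in> carrier (fusion_ring (Fib_power k))" if "\<And>y. y \<in> S \<Longrightarrow> h y \<in> carrier (fusion_ring (Fib_power k))" "finite S" for S :: "fib set" and i h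
  proof -
    have "Poly_Mapping.keys (\<Sum>y\<in>S. frag_cmul (c i y) (h y)) \<subseteq> (\<Union>y\<in>S. Poly_Mapping.keys (h y))"
      using keys_cmul by (intro order_trans[OF keys_sum]) blast
    with that show ?thesis unfolding Fib_power_ring_simps by blast
  qed
  case (insert x A)
  have hx: "h x y \<in> carrier (fusion_ring (Fib_power k))" for y using insert by auto
  have hA: "h i y \<in> carrier (fusion_ring (Fib_power k))" if "i \<in> A" for i y using insert that by auto
  have "(\<Sum>t\<in>(\<Pi>\<^sub>E i\<in>insert x A. UNIV). frag_cmul (\<Prod>i\<in>insert x A. c i (t i)) (\<Otimes>\<^bsub>fusion_ring (Fib_power k)\<^esub> i\<in>insert x A. h i (t i))) =
     (\<Sum>t\<in>(\<Pi>\<^sub>E i\<in>insert x A. UNIV). frag_cmul (c x (t x) * (\<Prod>i\<in>A. c i (t i))) (h x (t x) \<otimes>\<^bsub>fusion_ring (Fib_power k)\<^esub> (\<Otimes>\<^bsub>fusion_ring (Fib_power k)\<^esub> i\<in>A. h i (t i))))"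
    using insert.hyps hx hA by (intro sum.cong refl arg_cong2[of _ _ _ _ frag_cmul]) (auto simp: Pi_def)
  also have "\<dots> = (\<Sum>(y,t)\<in>UNIV \<times> (\<Pi>\<^sub>E i\<in>A. UNIV). frag_cmul (c x y * (\<Prod>i\<in>A. c i (t i))) (h x y \<otimes>\<^bsub>fusion_ring (Fib_power k)\<^esub> (\<Otimes>\<^bsub>fusion_ring (Fib_power k)\<^esub> i\<in>A. h i (t i))))"
  proof (rule sum.reindex_bij_witness[of _ "\<lambda>(y,g). g(x := y)" "\<lambda>g. (g x, g(x := undefined))"])
    fix t assume "t \<in> (\<Pi>\<^sub>E i\<in>insert x A. (UNIV :: fib set))"
    have "(\<Prod>i\<in>A. c i ((t(x := undefined)) i)) = (\<Prod>i\<in>A. c i (t i))"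
      using insert.hyps by (intro prod.cong) auto
    moreover have "(\<Otimes>\<^bsub>fusion_ring (Fib_power k)\<^esub> i\<in>A. h i ((t(x := undefined)) i)) = (\<Otimes>\<^bsub>fusion_ring (Fib_power k)\<^esub> i\<in>A. h i (t i))"
      using insert.hyps hA by (intro finprod_cong') auto
    ultimately show "(case (t x, t(x := undefined)) of (y, t) \<Rightarrow> frag_cmul (c x y * (\<Prod>i\<in>A. c i (t i))) (h x y \<otimes>\<^bsub>fusion_ring (Fib_power k)\<^esub> (\<Otimes>\<^bsub>fusion_ring (Fib_power k)\<^esub> i\<in>A. h i (t i)))) =
     frag_cmul (c x (t x) * (\<Prod>i\<in>A. c i (t i))) (h x (t x) \<otimes>\<^bsub>fusion_ring (Fib_power k)\<^esub> (\<Otimes>\<^bsub>fusion_ring (Fib_power k)\<^esub> i\<in>A. h i (t i)))"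
      by (simp only: prod.case)
  qed (use insert.hyps in \<open>auto simp: PiE_def extensional_def\<close>)
  also have "\<dots> = (\<Sum>y\<in>UNIV. \<Sum>t\<in>(\<Pi>\<^sub>E i\<in>A. UNIV). frag_cmul (c x y * (\<Prod>i\<in>A. c i (t i))) (h x y \<otimes>\<^bsub>fusion_ring (Fib_power k)\<^esub> (\<Otimes>\<^bsub>fusion_ring (Fib_power k)\<^esub> i\<in>A. h i (t i))))"
    by (subst sum.cartesian_product) auto
  also have "\<dots> = (\<Sum>y\<in>UNIV. frag_cmul (c x y) (h x y)) \<otimes>\<^bsub>fusion_ring (Fib_power k)\<^esub> (\<Sum>t\<in>(\<Pi>\<^sub>E i\<in>A. UNIV). frag_cmul (\<Prod>i\<in>A. c i (t i)) (\<Otimes>\<^bsub>fusion_ring (Fib_power k)\<^esub> i\<in>A. h i (t i)))"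
    unfolding Fib_power_ring_simps bilinear_extend_sum bilinear_extend_cmul frag_cmul_sum frag_cmul_cmul by (subst sum.swap) (simp add: mult.commute)
  also have "(\<Sum>t\<in>(\<Pi>\<^sub>E i\<in>A. UNIV). frag_cmul (\<Prod>i\<in>A. c i (t i)) (\<Otimes>\<^bsub>fusion_ring (Fib_power k)\<^esub> i\<in>A. h i (t i))) = (\<Otimes>\<^bsub>fusion_ring (Fib_power k)\<^esub> i\<in>A. \<Sum>y\<in>UNIV. frag_cmul (c i y) (h i y))"
    using insert.IH hA by blast
  also have "(\<Sum>y\<in>UNIV. frag_cmul (c x y) (h x y)) \<otimes>\<^bsub>fusion_ring (Fib_power k)\<^esub> \<dots> = (\<Otimes>\<^bsub>fusion_ring (Fib_power k)\<^esub> i\<in>insert x A. \<Sum>y\<in>UNIV. frag_cmul (c i y) (h i y))"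
    using insert.hyps by (subst finprod_insert) (auto intro!: sc hx hA)
  finally show ?case .
qed

lemma finprod_if:
  assumes "finite A" "g \<in> A \<rightarrow> carrier (fusion_ring (Fib_power k))"
  shows "(\<Otimes>\<^bsub>fusion_ring (Fib_power k)\<^esub> i\<in>{i\<in>A. Q i}. g i) = (\<Otimes>\<^bsub>fusion_ring (Fib_power k)\<^esub> i\<in>A. if Q i then g i else \<one>\<^bsub>fusion_ring (Fib_power k)\<^esub>)"
proof -
  interpret cring "fusion_ring (Fib_power k)" by (rule cring_Fib_power)
  show ?thesis using assms by (intro finprod_mono_neutral_cong_left) auto
qed

lemma nonneg_bilinear_extend: 
  assumes "nonneg a" "nonneg b" "\<And>r s. nonneg (f r s)"
  shows "nonneg (bilinear_extend f a b)"
proof -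
  have "nonneg (frag_extend (f r) b)" for r
    using assms by (auto simp: nonneg_def lookup_frag_extend[OF _ order_refl] intro!: sum_nonneg)
  then show ?thesis
    using assms by (auto simp: bilinear_extend_def nonneg_def lookup_frag_extend[OF _ order_refl] intro!: sum_nonneg)
qed

lemma nonneg_Fib_prod: fixes r s :: "nat \<Rightarrow> fib" shows "nonneg (Fib_prod k r s)"
proof -
  have "nonneg (fib_mult r s)" for r s
    by (cases r; cases s) (auto simp: nonneg_def lookup_add)
  then show ?thesis unfolding nonneg_def lookup_Fib_prod by (auto intro!: prod_nonneg)
qed

lemma Fib_power_selfadjoint:
  assumes "Poly_Mapping.keys a \<subseteq> (\<Pi>\<^sub>E i\<in>{1..k}. UNIV)" "m \<in> (\<Pi>\<^sub>E i\<in>{1..k}. UNIV)" "n \<in> (\<Pi>\<^sub>E i\<in>{1..k}. UNIV)"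
  shows "Poly_Mapping.lookup (bilinear_extend (Fib_prod k) a (frag_of m)) n = Poly_Mapping.lookup (bilinear_extend (Fib_prod k) a (frag_of n)) m"
  using assms(1)
proof (induction a rule: frag_induction)
  case (one r)
  have "(\<lambda>i\<in>{1..k}. r i) = r" using one by (simp add: PiE_restrict)
  then show ?case using fusion_ruleD2(4)[OF fusion_rule_Fib_power, of r k m n] one assms by simp
qed (auto simp: bilinear_extend_diff lookup_minus)

context
  fixes l k :: nat and P lam
  assumes P: "partition_on {1..l} P" and lam: "bij_betw lam {1..k} P"
begin

abbreviation "part_index i \<equiv> THE j. j \<in> {1..k} \<and> i \<in> lam j"

lemma part_index_eq: 
  assumes "j \<in> {1..k}" "i \<in> lam j"
  shows "part_index i = j"
proof (rule the_equality)
  fix j' assume j': "j' \<in> {1..k} \<and> i \<in> lam j'"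
  have "lam j \<in> P" "lam j' \<in> P" using bij_betwE[OF lam] assms j' by blast+
  then have "lam j = lam j'" using disjointD[OF partition_onD2[OF P], of "lam j" "lam j'"] assms j' by blast
  then show "j' = j" using inj_onD[OF bij_betw_imp_inj_on[OF lam]] assms j' by metis
qed (use assms in blast)

lemma part_index_in: assumes "i \<in> {1..l}" shows "part_index i \<in> {1..k}" "i \<in> lam (part_index i)"
proof -
  obtain p where "p \<in> P" "i \<in> p" using assms partition_onD1[OF P] by blast
  then obtain j where j: "j \<in> {1..k}" "i \<in> lam j" using bij_betw_imp_surj_on[OF lam] by blast
  show "part_index i \<in> {1..k}" "i \<in> lam (part_index i)" unfolding part_index_eq[OF j] by (rule j)+
qed

definition "part_gen i = frag_of (Fib_gen k (part_index i))"
definition "part_elt e = (\<Otimes>\<^bsub>fusion_ring (Fib_power k)\<^esub> i\<in>{i\<in>{1..l}. e i = FibX}. part_gen i)"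
definition "part_factor i y = (if y = FibX then part_gen i else \<one>\<^bsub>fusion_ring (Fib_power k)\<^esub>)"

lemma part_gen_closed: "part_gen i \<in> carrier (fusion_ring (Fib_power k))"
  unfolding Fib_power_ring_simps part_gen_def keys_frag_of using Fib_gen_basis by blast

lemma part_factor_closed: "part_factor i y \<in> carrier (fusion_ring (Fib_power k))"
proof -
  interpret cring "fusion_ring (Fib_power k)" by (rule cring_Fib_power)
  show ?thesis unfolding part_factor_def using part_gen_closed one_closed by (cases "y = FibX") (simp_all only: if_True if_False simp_thms)
qed

lemma part_elt_factor: "part_elt e = (\<Otimes>\<^bsub>fusion_ring (Fib_power k)\<^esub> i\<in>{1..l}. part_factor i (e i))"
  unfolding part_elt_def part_factor_def by (rule finprod_if) (use part_gen_closed in blast)+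

lemma part_elt_closed: "part_elt e \<in> carrier (fusion_ring (Fib_power k))"
proof -
  interpret cring "fusion_ring (Fib_power k)" by (rule cring_Fib_power)
  show ?thesis unfolding part_elt_factor using part_factor_closed by (intro finprod_closed) blast
qed

lemma part_factor_mult:
  assumes "i \<in> {1..l}"
  shows "part_factor i a \<otimes>\<^bsub>fusion_ring (Fib_power k)\<^esub> part_factor i b = (\<Sum>y\<in>UNIV. frag_cmul (Poly_Mapping.lookup (fib_mult a b) y) (part_factor i y))"
proof -
  interpret cring "fusion_ring (Fib_power k)" by (rule cring_Fib_power)
  have "part_gen i \<otimes>\<^bsub>fusion_ring (Fib_power k)\<^esub> part_gen i = \<one>\<^bsub>fusion_ring (Fib_power k)\<^esub> + part_gen i"
    unfolding Fib_power_ring_simps part_gen_def bilinear_extend_of by (rule Fib_gen_square[OF part_index_in(1)[OF assms]])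
  then show ?thesis
    using part_gen_closed[of i] l_one[OF part_gen_closed[of i]] r_one[OF part_gen_closed[of i]] l_one[OF one_closed]
    by (cases a; cases b) (simp_all add: UNIV_fib part_factor_def lookup_add)
qed

lemma part_elt_mult: "frag_extend part_elt (Fib_prod l e e') = part_elt e \<otimes>\<^bsub>fusion_ring (Fib_power k)\<^esub> part_elt e'"
proof -
  interpret cring "fusion_ring (Fib_power k)" by (rule cring_Fib_power)
  have "frag_extend part_elt (Fib_prod l e e') = (\<Sum>t\<in>(\<Pi>\<^sub>E i\<in>{1..l}. UNIV). frag_cmul (Poly_Mapping.lookup (Fib_prod l e e') t) (part_elt t))"
    by (rule frag_extend_superset) (auto simp: finite_PiE in_keys_iff lookup_Fib_prod PiE_iff extensional_def split: if_splits)
  also have "\<dots> = (\<Sum>t\<in>(\<Pi>\<^sub>E i\<in>{1..l}. UNIV). frag_cmul (\<Prod>i\<in>{1..l}. Poly_Mapping.lookup (fib_mult (e i) (e' i)) (t i)) (\<Otimes>\<^bsub>fusion_ring (Fib_power k)\<^esub> i\<in>{1..l}. part_factor i (t i)))"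
    by (intro sum.cong refl) (simp add: lookup_Fib_prod part_elt_factor PiE_def)
  also have "\<dots> = (\<Otimes>\<^bsub>fusion_ring (Fib_power k)\<^esub> i\<in>{1..l}. part_factor i (e i) \<otimes>\<^bsub>fusion_ring (Fib_power k)\<^esub> part_factor i (e' i))"
    by (subst finprod_sum_Fib_power) (auto intro!: part_factor_closed finprod_cong' simp: part_factor_mult intro: m_closed[OF part_factor_closed part_factor_closed, unfolded part_factor_mult])
  also have "\<dots> = part_elt e \<otimes>\<^bsub>fusion_ring (Fib_power k)\<^esub> part_elt e'"
    unfolding part_elt_factor using part_factor_closed by (intro finprod_multf) auto
  finally show ?thesis .
qed

lemma nonneg_part_elt: "nonneg (part_elt e)"
proof -
  interpret cring "fusion_ring (Fib_power k)" by (rule cring_Fib_power)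
  have n1: "nonneg (frag_of x)" for x :: "nat \<Rightarrow> fib" by (simp add: nonneg_def)
  have "nonneg (\<Otimes>\<^bsub>fusion_ring (Fib_power k)\<^esub> i\<in>A. part_factor i (e i))" if "finite A" for A
    using that
  proof (induction A rule: finite_induct)
    case empty show ?case unfolding finprod_empty unfolding Fib_power_ring_simps by (rule n1)
  next
    case (insert x A)
    have "nonneg (part_factor x (e x))" unfolding part_factor_def part_gen_def Fib_power_ring_simps using n1 by auto
    then have "nonneg (part_factor x (e x) \<otimes>\<^bsub>fusion_ring (Fib_power k)\<^esub> (\<Otimes>\<^bsub>fusion_ring (Fib_power k)\<^esub> i\<in>A. part_factor i (e i)))"
      unfolding Fib_power_ring_simps using nonneg_bilinear_extend nonneg_Fib_prod insert.IH by blast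
    then show ?case using insert.hyps part_factor_closed by (subst finprod_insert) auto
  qed
  then show ?thesis unfolding part_elt_factor by simp
qed

lemma nim_act_Fib_partition: "nim_act (Fib_partition l k lam) a v = frag_extend part_elt a \<otimes>\<^bsub>fusion_ring (Fib_power k)\<^esub> v"
proof -
  let ?B = "bilinear_extend (\<lambda>\<epsilon> m. bilinear_extend (Fib_prod k) (part_elt \<epsilon>) (frag_of m))"
  have 1: "?B (frag_of e) v = bilinear_extend (Fib_prod k) (part_elt e) v" for e
    using subset_UNIV[of "Poly_Mapping.keys v"]
    by (induction v rule: frag_induction) (auto simp: bilinear_extend_diff)
  have "?B a v = bilinear_extend (Fib_prod k) (frag_extend part_elt a) v"
    using subset_UNIV[of "Poly_Mapping.keys a"]
    by (induction a rule: frag_induction) (auto simp: bilinear_extend_diff 1 frag_extend_diff)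
  then show ?thesis
    by (simp add: Fib_partition_def Let_def Fib_power_ring_simps) (simp add: part_elt_def part_gen_def)
qed

lemma nim_set_Fib_partition [simp]: "nim_set (Fib_partition l k lam) = (\<Pi>\<^sub>E i\<in>{1..k}. UNIV)"
  by (simp add: Fib_partition_def Let_def)

lemma part_elt_extend_closed: "frag_extend part_elt a \<in> carrier (fusion_ring (Fib_power k))"
  using part_elt_closed keys_frag_extend[of part_elt a] unfolding Fib_power_ring_simps by blast

lemma nim_act_Fib_partition_gen:
  assumes "j \<in> {1..k}" "i \<in> lam j"
  shows "nim_act (Fib_partition l k lam) (frag_of (Fib_gen l i)) v = fus_mult (Fib_power k) (frag_of (Fib_gen k j)) v"
proof -
  interpret cring "fusion_ring (Fib_power k)" by (rule cring_Fib_power)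
  have "i \<in> {1..l}" using assms bij_betwE[OF lam] partition_onD1[OF P] by blast
  then have "{i'\<in>{1..l}. Fib_gen l i i' = FibX} = {i}" by (auto simp: Fib_gen_def)
  then have "part_elt (Fib_gen l i) = part_gen i" unfolding part_elt_def using part_gen_closed r_one[OF part_gen_closed] by simp
  also have "\<dots> = frag_of (Fib_gen k j)" by (simp only: part_gen_def part_index_eq[OF assms])
  finally show ?thesis by (simp add: nim_act_Fib_partition Fib_power_ring_simps)
qed

lemma nim_rep_Fib_partition: "nim_rep (Fib_power l) (Fib_partition l k lam)"
  unfolding nim_rep_def
proof (intro conjI ballI)
  interpret cring "fusion_ring (Fib_power k)" by (rule cring_Fib_power)
  have C: "ZZ (nim_set (Fib_partition l k lam)) = carrier (fusion_ring (Fib_power k))" by (auto simp: fusion_ring_def)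
  have U: "frag_extend part_elt (frag_of (fus_unit (Fib_power l))) = \<one>\<^bsub>fusion_ring (Fib_power k)\<^esub>"
  proof -
    have "{i\<in>{1..l}. (\<lambda>i\<in>{1..l}. Fib1) i = FibX} = {}" by auto
    then show ?thesis unfolding Fib_power_simps frag_extend_of part_elt_def by (simp only: finprod_empty)
  qed
  let ?M = "Fib_partition l k lam"
  fix a b v w assume v: "v \<in> ZZ (nim_set ?M)" and w: "w \<in> ZZ (nim_set ?M)"
  show "nim_act ?M a v \<in> ZZ (nim_set ?M)"
    using m_closed[OF part_elt_extend_closed, of v a] v unfolding nim_act_Fib_partition C by blast
  show "nim_act ?M a (v + w) = nim_act ?M a v + nim_act ?M a w"
     "nim_act ?M (a + b) v = nim_act ?M a v + nim_act ?M b v"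
    by (simp_all add: nim_act_Fib_partition Fib_power_ring_simps bilinear_extend_add frag_extend_add)
  show "nim_act ?M (frag_of (fus_unit (Fib_power l))) v = v"
    unfolding nim_act_Fib_partition U by (rule l_one) (use v in \<open>simp only: C\<close>)
  have "frag_extend part_elt (bilinear_extend (Fib_prod l) a b) = bilinear_extend (Fib_prod k) (frag_extend part_elt a) (frag_extend part_elt b)"
  proof -
    have 1: "frag_extend part_elt (bilinear_extend (Fib_prod l) (frag_of r) b) = bilinear_extend (Fib_prod k) (part_elt r) (frag_extend part_elt b)" for r b
      using subset_UNIV[of "Poly_Mapping.keys b"]
      by (induction b rule: frag_induction) (auto simp: bilinear_extend_diff frag_extend_diff part_elt_mult Fib_power_ring_simps)
    show ?thesis
      using subset_UNIV[of "Poly_Mapping.keys a"]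
      by (induction a rule: frag_induction) (auto simp: bilinear_extend_diff frag_extend_diff 1)
  qed
  then show "nim_act ?M (fus_mult (Fib_power l) a b) v = nim_act ?M a (nim_act ?M b v)"
    unfolding nim_act_Fib_partition using m_assoc[OF part_elt_extend_closed part_elt_extend_closed, of v a b] v C by (simp add: Fib_power_ring_simps)
next
  fix r m
  show "nonneg (nim_act (Fib_partition l k lam) (frag_of r) (frag_of m))"
    unfolding nim_act_Fib_partition Fib_power_ring_simps frag_extend_of by (intro nonneg_bilinear_extend nonneg_part_elt nonneg_Fib_prod) (simp add: nonneg_def)
next
  fix r m n assume r: "r \<in> fus_basis (Fib_power l)" and mn: "m \<in> nim_set (Fib_partition l k lam)" "n \<in> nim_set (Fib_partition l k lam)"
  have "fus_dual (Fib_power l) r = r" using r by (simp add: PiE_restrict)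
  then show "form (nim_act (Fib_partition l k lam) (frag_of r) (frag_of m)) (frag_of n) =
       form (frag_of m) (nim_act (Fib_partition l k lam) (frag_of (fus_dual (Fib_power l) r)) (frag_of n))"
    unfolding nim_act_Fib_partition form_of Fib_power_ring_simps frag_extend_of using Fib_power_selfadjoint[OF part_elt_closed[unfolded Fib_power_ring_simps]] mn
    by (simp del: Fib_power_simps)
qed

end

declare One_nat_def [simp] PiE_UNIV_domain [simp]

end

theory Submission
  imports Defs
begin

text \<open>
  A generator \<open>x\<^sub>i\<close> acts by a symmetric non-negative integer matrix \<open>A\<^sub>i\<close> with \<open>A\<^sub>i\<^sup>2 = 1 + A\<^sub>i\<close>.
  On the diagonal this says that the squares of the entries in row \<open>m\<close> sum to one plus the diagonal
  entry, so \<open>A\<^sub>i m = s\<^sub>i m\<close> or \<open>A\<^sub>i m = s\<^sub>i m + m\<close>, where \<open>s\<^sub>i\<close> is a fixed-point-free involution that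
  exchanges the two cases. Comparing coefficients in \<open>A\<^sub>i A\<^sub>j = A\<^sub>j A\<^sub>i\<close> shows that the involutions
  commute, that \<open>A\<^sub>i m = A\<^sub>j m\<close> if \<open>s\<^sub>i m = s\<^sub>j m\<close>, and that otherwise \<open>s\<^sub>j\<close> does not change the case of \<open>m\<close>
  with respect to \<open>A\<^sub>i\<close>. Indecomposability makes the group generated by the \<open>s\<^sub>i\<close> transitive, so
  \<open>s\<^sub>i m = s\<^sub>j m\<close> for one \<open>m\<close> implies \<open>s\<^sub>i = s\<^sub>j\<close>. The classes of equal \<open>s\<^sub>i\<close> are the parts of the
  partition, and recording the case of \<open>m\<close> for each part identifies the module with a cube.
\<close>

declare One_nat_def [simp del] PiE_UNIV_domain [simp del]

section \<open>Linear algebra of modules over a fusion ring\<close>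

text \<open>Carries membership in \<open>ZZ S\<close> through the induction, because the module
  axioms hold only for elements of \<open>ZZ\<close>.\<close>

lemma ZZ_induct [consumes 1, case_names zero one diff]:
  assumes "c \<in> ZZ S" "P 0" "\<And>x. x \<in> S \<Longrightarrow> P (frag_of x)"
    "\<And>a b. a \<in> ZZ S \<Longrightarrow> b \<in> ZZ S \<Longrightarrow> P a \<Longrightarrow> P b \<Longrightarrow> P (a - b)"
  shows "P c"
proof -
  have "Poly_Mapping.keys c \<subseteq> S" using assms(1) by simp
  then have "c \<in> ZZ S \<and> P c"
  proof (induction c rule: frag_induction)
    case (diff a b)
    then show ?case using assms(4)[of a b] keys_diff[of a b] by auto
  qed (use assms(2,3) in auto)
  then show ?thesis by simp
qed

lemma nim_repD:
  assumes "nim_rep R M"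
  shows "a \<in> ZZ (fus_basis R) \<Longrightarrow> v \<in> ZZ (nim_set M) \<Longrightarrow> nim_act M a v \<in> ZZ (nim_set M)"
    "a \<in> ZZ (fus_basis R) \<Longrightarrow> v \<in> ZZ (nim_set M) \<Longrightarrow> w \<in> ZZ (nim_set M) \<Longrightarrow>
       nim_act M a (v + w) = nim_act M a v + nim_act M a w"
    "a \<in> ZZ (fus_basis R) \<Longrightarrow> b \<in> ZZ (fus_basis R) \<Longrightarrow> v \<in> ZZ (nim_set M) \<Longrightarrow>
       nim_act M (a + b) v = nim_act M a v + nim_act M b v"
    "a \<in> ZZ (fus_basis R) \<Longrightarrow> b \<in> ZZ (fus_basis R) \<Longrightarrow> v \<in> ZZ (nim_set M) \<Longrightarrow>
       nim_act M (fus_mult R a b) v = nim_act M a (nim_act M b v)"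
    "v \<in> ZZ (nim_set M) \<Longrightarrow> nim_act M (frag_of (fus_unit R)) v = v"
    "r \<in> fus_basis R \<Longrightarrow> m \<in> nim_set M \<Longrightarrow> nonneg (nim_act M (frag_of r) (frag_of m))"
    "r \<in> fus_basis R \<Longrightarrow> m \<in> nim_set M \<Longrightarrow> n \<in> nim_set M \<Longrightarrow>
       Poly_Mapping.lookup (nim_act M (frag_of r) (frag_of m)) n =
       Poly_Mapping.lookup (nim_act M (frag_of (fus_dual R r)) (frag_of n)) m"
  using assms unfolding nim_rep_def form_of by blast+

lemma ZZ_diff: "a \<in> ZZ S \<Longrightarrow> b \<in> ZZ S \<Longrightarrow> a - b \<in> ZZ S"
  using keys_diff[of a b] by auto

lemma ZZ_add: "a \<in> ZZ S \<Longrightarrow> b \<in> ZZ S \<Longrightarrow> a + b \<in> ZZ S"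
  using Poly_Mapping.keys_add[of a b] by auto

lemma nim_act_diff:
  assumes "nim_rep R M" "a \<in> ZZ (fus_basis R)" "v \<in> ZZ (nim_set M)"
  shows "b \<in> ZZ (fus_basis R) \<Longrightarrow> nim_act M (a - b) v = nim_act M a v - nim_act M b v"
    "w \<in> ZZ (nim_set M) \<Longrightarrow> nim_act M a (v - w) = nim_act M a v - nim_act M a w"
  using nim_repD(3)[OF assms(1) ZZ_diff, of a b b v] nim_repD(2)[OF assms(1,2) ZZ_diff, of v w w]
    assms by (simp_all only: diff_add_cancel eq_diff_eq)

lemma nim_act_0:
  assumes "nim_rep R M"
  shows "v \<in> ZZ (nim_set M) \<Longrightarrow> nim_act M 0 v = 0" "a \<in> ZZ (fus_basis R) \<Longrightarrow> nim_act M a 0 = 0"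
  using nim_act_diff(1)[OF assms, of 0 v 0] nim_act_diff(2)[OF assms, of a 0 0] by simp_all

lemma frag_extend_of_ZZ:
  assumes "f \<in> S \<rightarrow> T" "v \<in> ZZ S"
  shows "frag_extend (\<lambda>m. frag_of (f m)) v \<in> ZZ T"
  using keys_frag_extend[of "\<lambda>m. frag_of (f m)" v] assms by fastforce

text \<open>Extended linearly, \<open>f\<close> and \<open>g\<close> are mutually inverse, so
  writing \<open>v\<close> as the image of its preimage transfers equivariance from \<open>f\<close>
  to \<open>g\<close>. For an isomorphism only one direction then needs a computation.\<close>

lemma nim_morphism_inverse:
  assumes N: "nim_rep R M" "nim_rep R N" and f: "nim_morphism R M N f"
    and g: "g \<in> nim_set N \<rightarrow> nim_set M" and gf: "\<And>m. m \<in> nim_set M \<Longrightarrow> g (f m) = m"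
    and fg: "\<And>n. n \<in> nim_set N \<Longrightarrow> f (g n) = n"
  shows "nim_morphism R N M g"
  unfolding nim_morphism_def
proof (intro conjI ballI g)
  fix a v assume a: "a \<in> ZZ (fus_basis R)" and v: "v \<in> ZZ (nim_set N)"
  let ?f = "frag_extend (\<lambda>m. frag_of (f m))" and ?g = "frag_extend (\<lambda>n. frag_of (g n))"
  have 1: "?g (?f w) = w" if "w \<in> ZZ (nim_set M)" for w
    using that by (induction w rule: ZZ_induct) (simp_all add: gf frag_extend_diff)
  have 2: "?f (?g w) = w" if "w \<in> ZZ (nim_set N)" for w
    using that by (induction w rule: ZZ_induct) (simp_all add: fg frag_extend_diff)
  have gv: "?g v \<in> ZZ (nim_set M)" by (rule frag_extend_of_ZZ[OF g v])
  have "?g (nim_act N a v) = ?g (?f (nim_act M a (?g v)))"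
    using f a gv 2[OF v] unfolding nim_morphism_def by metis
  then show "?g (nim_act N a v) = nim_act M a (?g v)"
    using 1 nim_repD(1)[OF N(1) a gv] by metis
qed

section \<open>Reduction to the generators of the Fibonacci power\<close>

definition fib_flip :: "nat \<Rightarrow> (nat \<Rightarrow> fib) \<Rightarrow> (nat \<Rightarrow> fib)" where
  "fib_flip j e = e(j := if e j = Fib1 then FibX else Fib1)"

text \<open>The structure constant is a product over the coordinates: each factor away from
  \<open>j\<close> is a Kronecker delta, and factor \<open>j\<close> comes from
  \<open>fib_mult FibX\<close>. This is the normal form that the action on an arbitrary module is
  later matched against.\<close>

lemma Fib_prod_gen:
  assumes e: "e \<in> (\<Pi>\<^sub>E i\<in>{1..k}. UNIV)" and j: "j \<in> {1..k}"
  shows "Fib_prod k (Fib_gen k j) e = frag_of (fib_flip j e) + (if e j = FibX then frag_of e else 0)"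
proof (rule poly_mapping_eqI)
  fix t
  let ?S = "{1..k} - {j}"
  have E: "t = e(j := a) \<longleftrightarrow> t \<in> extensional {1..k} \<and> t j = a \<and> (\<forall>i\<in>?S. t i = e i)" for a
  proof
    assume R: "t \<in> extensional {1..k} \<and> t j = a \<and> (\<forall>i\<in>?S. t i = e i)"
    show "t = e(j := a)"
      by (rule extensionalityI[of _ "{1..k}"]) (use R j e in \<open>auto simp: PiE_iff extensional_def\<close>)
  qed (use j e in \<open>auto simp: PiE_iff extensional_def\<close>)
  have E1: "t = e \<longleftrightarrow> t \<in> extensional {1..k} \<and> t j = e j \<and> (\<forall>i\<in>?S. t i = e i)"
    using E[of "e j"] by simp
  have I: "{1..k} = insert j ?S" using j by auto
  have P: "(\<Prod>i\<in>?S. Poly_Mapping.lookup (fib_mult (Fib_gen k j i) (e i)) (t i)) =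
      (if \<forall>i\<in>?S. t i = e i then 1 else 0)"
  proof (cases "\<forall>i\<in>?S. t i = e i")
    case True then show ?thesis by (auto simp: Fib_gen_def intro!: prod.neutral)
  next
    case False then show ?thesis by (auto simp: Fib_gen_def intro!: prod_zero)
  qed
  have "(\<Prod>i\<in>{1..k}. Poly_Mapping.lookup (fib_mult (Fib_gen k j i) (e i)) (t i)) =
     Poly_Mapping.lookup (fib_mult FibX (e j)) (t j) * (if \<forall>i\<in>?S. t i = e i then 1 else 0)"
    unfolding P[symmetric] using j by (subst I, subst prod.insert) (auto simp: Fib_gen_def)
  then show "Poly_Mapping.lookup (Fib_prod k (Fib_gen k j) e) t =
      Poly_Mapping.lookup (frag_of (fib_flip j e) + (if e j = FibX then frag_of e else 0)) t"
    unfolding lookup_Fib_prod lookup_add fib_flip_def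
    by (cases "t j"; cases "e j") (auto simp: lookup_add E E1 lookup_frag_of)
qed

text \<open>Induction on the number of coordinates equal to \<open>FibX\<close>. Raising one
  coordinate is multiplication by a generator (\<open>frag_of_Fib_upd\<close>), so claims about all
  basis elements reduce to the generators.\<close>

lemma Fib_power_induct [consumes 1, case_names unit gen]:
  fixes e :: "nat \<Rightarrow> fib" and l :: nat
  assumes "e \<in> (\<Pi>\<^sub>E i\<in>{1..l}. UNIV)" "P (\<lambda>i\<in>{1..l}. Fib1)"
    "\<And>e i. e \<in> (\<Pi>\<^sub>E i\<in>{1..l}. UNIV) \<Longrightarrow> i \<in> {1..l} \<Longrightarrow> e i = Fib1 \<Longrightarrow> P e \<Longrightarrow> P (e(i := FibX))"
  shows "P e"
proof -
  have fin: "finite {i\<in>{1..l}. Q i}" for Q by simp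
  show ?thesis
    using assms(1)
  proof (induction "card {i\<in>{1..l}. e i = FibX}" arbitrary: e)
    case 0
    have "e = (\<lambda>i\<in>{1..l}. Fib1)"
    proof (rule extensionalityI[of _ "{1..l}"])
      fix i assume i: "i \<in> {1..l}"
      have "{i\<in>{1..l}. e i = FibX} = {}" using 0(1) card_0_eq[OF fin] by (simp only: eq_commute)
      then have "e i \<noteq> FibX" using i by blast
      then show "e i = (\<lambda>i\<in>{1..l}. Fib1) i" using i by (cases "e i") simp_all
    qed (use 0(2) in \<open>auto simp: PiE_def\<close>)
    then show ?case using assms(2) by (simp only:)
  next
    case (Suc n)
    have "card {i\<in>{1..l}. e i = FibX} \<noteq> 0" unfolding Suc(2)[symmetric] by simp
    then have "{i\<in>{1..l}. e i = FibX} \<noteq> {}" by (rule contrapos_nn) (simp only: card.empty)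
    then obtain i where i: "i \<in> {1..l}" "e i = FibX" by blast
    let ?e = "e(i := Fib1)"
    have "{i'\<in>{1..l}. e i' = FibX} = insert i {i'\<in>{1..l}. ?e i' = FibX}" using i by auto
    then have "Suc n = card (insert i {i'\<in>{1..l}. ?e i' = FibX})" using Suc(2) by (simp only:)
    also have "\<dots> = Suc (card {i'\<in>{1..l}. ?e i' = FibX})" by (rule card_insert_disjoint[OF fin]) simp
    finally have "n = card {i'\<in>{1..l}. ?e i' = FibX}" by simp
    moreover have e: "?e \<in> (\<Pi>\<^sub>E i\<in>{1..l}. UNIV)" using Suc.prems i by (auto simp: PiE_iff extensional_def)
    ultimately have "P ?e" by (rule Suc.hyps(1))
    then have "P (?e(i := FibX))" by (intro assms(3)[OF e i(1)]) simp
    then show ?case using i(2) by (simp add: fun_upd_idem)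
  qed
qed

text \<open>The assumption \<open>e i = Fib1\<close> kills the second summand of
  \<open>Fib_prod_gen\<close>, leaving a single basis element.\<close>

lemma frag_of_Fib_upd:
  assumes "e \<in> (\<Pi>\<^sub>E i\<in>{1..l}. UNIV)" "i \<in> {1..l}" "e i = Fib1"
  shows "frag_of (e(i := FibX)) = fus_mult (Fib_power l) (frag_of (Fib_gen l i)) (frag_of e)"
  using assms by (simp add: Fib_prod_gen fib_flip_def)

text \<open>Equivariance spreads in three stages: to all vectors by linearity, to all basis elements
  of the ring by \<open>Fib_power_induct\<close>, and to the whole ring by linearity again.\<close>

lemma nim_morphism_Fib_powerI:
  assumes M: "nim_rep (Fib_power l) M" and N: "nim_rep (Fib_power l) N"
    and f: "f \<in> nim_set M \<rightarrow> nim_set N"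
    and gen: "\<And>i m. i \<in> {1..l} \<Longrightarrow> m \<in> nim_set M \<Longrightarrow>
       frag_extend (\<lambda>m. frag_of (f m)) (nim_act M (frag_of (Fib_gen l i)) (frag_of m)) =
       nim_act N (frag_of (Fib_gen l i)) (frag_of (f m))"
  shows "nim_morphism (Fib_power l) M N f"
  unfolding nim_morphism_def
proof (intro conjI ballI f)
  let ?f = "frag_extend (\<lambda>m. frag_of (f m))" and ?B = "fus_basis (Fib_power l)"
  have G: "frag_of (Fib_gen l i) \<in> ZZ ?B" for i using Fib_gen_basis by simp
  note fZ = frag_extend_of_ZZ[OF f]
  have 1: "?f (nim_act M (frag_of (Fib_gen l i)) v) = nim_act N (frag_of (Fib_gen l i)) (?f v)"
    if v: "v \<in> ZZ (nim_set M)" and i: "i \<in> {1..l}" for i v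
    using v
  proof (induction v rule: ZZ_induct)
    case (diff a b)
    then show ?case
      using nim_act_diff(2)[OF M G diff(1,2)] nim_act_diff(2)[OF N G fZ fZ, OF diff(1,2)]
      by (simp only: frag_extend_diff)
  next
    case zero show ?case by (simp only: nim_act_0(2)[OF M G] nim_act_0(2)[OF N G] frag_extend_0)
  next
    case (one m) show ?case unfolding frag_extend_of by (rule gen[OF i one])
  qed
  have 2: "?f (nim_act M (frag_of e) v) = nim_act N (frag_of e) (?f v)"
    if e: "e \<in> (\<Pi>\<^sub>E i\<in>{1..l}. UNIV)" and v: "v \<in> ZZ (nim_set M)" for e v
    using e
  proof (induction e rule: Fib_power_induct)
    case unit
    show ?case
      using nim_repD(5)[OF M v] nim_repD(5)[OF N fZ[OF v]] by (simp only: Fib_power_simps(3))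
  next
    case (gen e i)
    have e: "frag_of e \<in> ZZ ?B" using gen by simp
    have m: "nim_act M (frag_of e) v \<in> ZZ (nim_set M)" by (rule nim_repD(1)[OF M e v])
    show ?case
      unfolding frag_of_Fib_upd[OF gen(1-3)] nim_repD(4)[OF M G e v] nim_repD(4)[OF N G e fZ[OF v]]
        1[OF m gen(2)] gen(4) ..
  qed
  fix a v assume a: "a \<in> ZZ ?B" and v: "v \<in> ZZ (nim_set M)"
  show "?f (nim_act M a v) = nim_act N a (?f v)"
    using a
  proof (induction a rule: ZZ_induct)
    case (diff a b)
    then show ?case
      using nim_act_diff(1)[OF M _ v, of a b] nim_act_diff(1)[OF N _ fZ[OF v], of a b]
      by (simp only: frag_extend_diff)
  next
    case zero then show ?case using nim_act_0(1)[OF M v] nim_act_0(1)[OF N fZ[OF v]] by simp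
  next
    case (one e) then show ?case using 2[of e v] v by simp
  qed
qed

text \<open>Closure of \<open>ZZ A\<close> spreads in the same three stages as equivariance above;
  the remaining axioms are inherited from \<open>M\<close>.\<close>

lemma nim_subrep_Fib_powerI:
  assumes M: "nim_rep (Fib_power l) M" and A: "A \<subseteq> nim_set M"
    and gen: "\<And>i m. i \<in> {1..l} \<Longrightarrow> m \<in> A \<Longrightarrow> nim_act M (frag_of (Fib_gen l i)) (frag_of m) \<in> ZZ A"
  shows "nim_subrep (Fib_power l) M A"
proof -
  let ?B = "fus_basis (Fib_power l)"
  have ZA: "v \<in> ZZ (nim_set M)" if "v \<in> ZZ A" for v using that A by auto
  have G: "frag_of (Fib_gen l i) \<in> ZZ ?B" for i using Fib_gen_basis by simp
  have 1: "nim_act M (frag_of (Fib_gen l i)) v \<in> ZZ A" if "v \<in> ZZ A" "i \<in> {1..l}" for i v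
    using that(1)
  proof (induction v rule: ZZ_induct)
    case (diff a b)
    show ?case unfolding nim_act_diff(2)[OF M G ZA ZA, OF diff(1,2)] by (rule ZZ_diff[OF diff(3,4)])
  next
    case zero show ?case unfolding nim_act_0(2)[OF M G] by simp
  next
    case (one m) show ?case by (rule gen[OF that(2) one])
  qed
  have 2: "nim_act M (frag_of e) v \<in> ZZ A" if e: "e \<in> (\<Pi>\<^sub>E i\<in>{1..l}. UNIV)" and v: "v \<in> ZZ A" for e v
    using e
  proof (induction e rule: Fib_power_induct)
    case unit
    show ?case using nim_repD(5)[OF M ZA[OF v]] v by (simp only: Fib_power_simps(3))
  next
    case (gen e i)
    have e: "frag_of e \<in> ZZ ?B" using gen by simp
    show ?case
      unfolding frag_of_Fib_upd[OF gen(1-3)] nim_repD(4)[OF M G e ZA[OF v]]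
      by (rule 1[OF gen(4,2)])
  qed
  have 3: "nim_act M a v \<in> ZZ A" if a: "a \<in> ZZ ?B" and v: "v \<in> ZZ A" for a v
    using a
  proof (induction a rule: ZZ_induct)
    case (diff a b)
    show ?case unfolding nim_act_diff(1)[OF M diff(1) ZA[OF v] diff(2)] by (rule ZZ_diff[OF diff(3,4)])
  next
    case zero then show ?case using nim_act_0(1)[OF M ZA[OF v]] by simp
  next
    case (one e) then show ?case using 2[of e v] v by simp
  qed
  have upd: "nim_set (M\<lparr>nim_set := A\<rparr>) = A" "nim_act (M\<lparr>nim_set := A\<rparr>) = nim_act M" by simp_all
  have "nim_rep (Fib_power l) (M\<lparr>nim_set := A\<rparr>)"
    unfolding nim_rep_def upd form_of
  proof (intro conjI ballI)
    fix a b v w assume a: "a \<in> ZZ ?B" and b: "b \<in> ZZ ?B" and v: "v \<in> ZZ A" and w: "w \<in> ZZ A"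
    show "nim_act M a v \<in> ZZ A" by (rule 3[OF a v])
    show "nim_act M a (v + w) = nim_act M a v + nim_act M a w" by (rule nim_repD(2)[OF M a ZA[OF v] ZA[OF w]])
    show "nim_act M (a + b) v = nim_act M a v + nim_act M b v" by (rule nim_repD(3)[OF M a b ZA[OF v]])
    show "nim_act M (fus_mult (Fib_power l) a b) v = nim_act M a (nim_act M b v)"
      by (rule nim_repD(4)[OF M a b ZA[OF v]])
  next
    fix v assume "v \<in> ZZ A"
    then show "nim_act M (frag_of (fus_unit (Fib_power l))) v = v" by (rule nim_repD(5)[OF M ZA])
  next
    fix r m n assume r: "r \<in> ?B" and m: "m \<in> A" and n: "n \<in> A"
    show "nonneg (nim_act M (frag_of r) (frag_of m))" by (rule nim_repD(6)[OF M r subsetD[OF A m]])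
    show "Poly_Mapping.lookup (nim_act M (frag_of r) (frag_of m)) n =
        Poly_Mapping.lookup (nim_act M (frag_of (fus_dual (Fib_power l) r)) (frag_of n)) m"
      by (rule nim_repD(7)[OF M r subsetD[OF A m] subsetD[OF A n]])
  qed
  then show ?thesis unfolding nim_subrep_def by (rule conjI[OF A])
qed

section \<open>Rows of a symmetric matrix with square 1 + A\<close>

lemma sum_squares_eq_1:
  fixes c :: "'a \<Rightarrow> int"
  assumes "finite K" "\<And>n. n \<in> K \<Longrightarrow> 1 \<le> c n" "(\<Sum>n\<in>K. (c n)\<^sup>2) = 1"
  shows "\<exists>n. K = {n} \<and> c n = 1"
proof -
  have "(\<Sum>n\<in>K. 1) \<le> (\<Sum>n\<in>K. (c n)\<^sup>2)"
    using assms(2) by (intro sum_mono) (simp add: one_le_power)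
  then have "card K \<le> 1" using assms by simp
  moreover have "card K \<noteq> 0" using assms by auto
  ultimately have "card K = 1" by simp
  then obtain n where n: "K = {n}" by (rule card_1_singletonE)
  then have "(c n)\<^sup>2 = 1" using assms(3) by simp
  then show ?thesis using n assms(2)[of n] by (auto simp: power2_eq_1_iff)
qed

lemma frag_of_if_keys_eq:
  assumes "Poly_Mapping.keys c = {n}" "Poly_Mapping.lookup c n = 1"
  shows "c = frag_of n"
proof (rule poly_mapping_eqI)
  fix x
  have "x \<noteq> n \<Longrightarrow> Poly_Mapping.lookup c x = 0" using assms(1) by (metis in_keys_iff singletonD)
  then show "Poly_Mapping.lookup c x = Poly_Mapping.lookup (frag_of n) x"
    using assms(2) by (cases "x = n") auto
qed

text \<open>
  The hypothesis is the diagonal entry of \<open>A\<^sup>2 = 1 + A\<close> for a symmetric matrix \<open>A\<close> with row \<open>c\<close>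
  at the index \<open>m\<close>.
\<close>

lemma fib_matrix_row:
  fixes c :: "'m \<Rightarrow>\<^sub>0 int"
  assumes c: "nonneg c"
    and eq: "(\<Sum>n\<in>Poly_Mapping.keys c. (Poly_Mapping.lookup c n)\<^sup>2) = 1 + Poly_Mapping.lookup c m"
  shows "\<exists>n. n \<noteq> m \<and> (c = frag_of n \<or> c = frag_of n + frag_of m)"
proof -
  let ?c = "Poly_Mapping.lookup c"
  have pos: "1 \<le> ?c n" if "n \<in> Poly_Mapping.keys c" for n
    using c that unfolding nonneg_def in_keys_iff by (metis linorder_not_less order_antisym zless_imp_add1_zle add_0 )
  show ?thesis
  proof (cases "m \<in> Poly_Mapping.keys c")
    case False
    then have "(\<Sum>n\<in>Poly_Mapping.keys c. (?c n)\<^sup>2) = 1" using eq by (simp add: in_keys_iff)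
    from sum_squares_eq_1[OF finite_keys pos this]
    obtain n where n: "Poly_Mapping.keys c = {n}" "?c n = 1" by blast
    have "n \<noteq> m" using False unfolding n(1) by simp
    then show ?thesis using frag_of_if_keys_eq[OF n] by metis
  next
    case True
    let ?K = "Poly_Mapping.keys c - {m}"
    have s: "(\<Sum>n\<in>?K. (?c n)\<^sup>2) = 1 + ?c m - (?c m)\<^sup>2"
      using sum.remove[OF finite_keys True, of "\<lambda>n. (?c n)\<^sup>2"] eq by simp
    \<comment> \<open>A diagonal entry of at least 2 would leave at most \<open>1 - ?c m\<close>, a
      negative number, for the sum of the other squares.\<close>
    have m1: "?c m = 1"
    proof (rule ccontr)
      assume "?c m \<noteq> 1"
      then have "2 \<le> ?c m" using pos[OF True] by simp
      then have "2 * ?c m \<le> (?c m)\<^sup>2" by (simp add: power2_eq_square)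
      moreover have "0 \<le> (\<Sum>n\<in>?K. (?c n)\<^sup>2)" by (intro sum_nonneg) simp
      ultimately show False using s \<open>2 \<le> ?c m\<close> by linarith
    qed
    obtain n where n: "?K = {n}" "?c n = 1"
    proof -
      have "(\<Sum>n\<in>?K. (?c n)\<^sup>2) = 1" using s m1 by simp
      from sum_squares_eq_1[OF finite_Diff[OF finite_keys] pos this] show thesis using that by blast
    qed
    have "c = frag_of n + frag_of m"
    proof (rule poly_mapping_eqI)
      fix x
      have "x = n \<or> x = m \<or> ?c x = 0" using n(1) by (metis DiffI in_keys_iff singletonD)
      moreover have "n \<noteq> m" using n(1) by (metis Diff_iff singletonI)
      ultimately show "?c x = Poly_Mapping.lookup (frag_of n + frag_of m) x"
        using n(2) m1 by (auto simp: lookup_add lookup_frag_of)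
    qed
    then show ?thesis using n(1) by (metis Diff_iff singletonI)
  qed
qed

section \<open>The involutions attached to the generators\<close>

locale fib_action =
  fixes l :: nat and M :: "(nat \<Rightarrow> fib, 'm) nim_data"
  assumes nim_rep: "nim_rep (Fib_power l) M"
begin

definition gen_act :: "nat \<Rightarrow> 'm \<Rightarrow> ('m \<Rightarrow>\<^sub>0 int)" where
  "gen_act i m = nim_act M (frag_of (Fib_gen l i)) (frag_of m)"

text \<open>
  With these definitions \<open>x\<^sub>i m\<close> is \<open>partner i m\<close>, plus \<open>m\<close> itself if \<open>loop i m\<close>; the description
  in \<open>partner\<close> is proper only for \<open>i \<in> {1..l}\<close> and \<open>m\<close> in the module.
\<close>

definition partner :: "nat \<Rightarrow> 'm \<Rightarrow> 'm" where
  "partner i m = (THE n. n \<noteq> m \<and> n \<in> Poly_Mapping.keys (gen_act i m))"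

definition loop :: "nat \<Rightarrow> 'm \<Rightarrow> bool" where
  "loop i m \<longleftrightarrow> m \<in> Poly_Mapping.keys (gen_act i m)"

lemma gen_ZZ: "frag_of (Fib_gen l i) \<in> ZZ (fus_basis (Fib_power l))"
  using Fib_gen_basis by simp

lemma gen_act_closed: "m \<in> nim_set M \<Longrightarrow> gen_act i m \<in> ZZ (nim_set M)"
  unfolding gen_act_def by (intro nim_repD(1)[OF nim_rep gen_ZZ]) simp

lemma nim_act_gen:
  assumes "v \<in> ZZ (nim_set M)"
  shows "nim_act M (frag_of (Fib_gen l i)) v = frag_extend (gen_act i) v"
  using assms
proof (induction v rule: ZZ_induct)
  case (diff a b)
  then show ?case using nim_act_diff(2)[OF nim_rep gen_ZZ diff(1,2)] by (simp only: frag_extend_diff)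
qed (simp_all add: gen_act_def nim_act_0(2)[OF nim_rep gen_ZZ])

text \<open>Turns relations between generators in the ring into relations between their matrices;
  the next two lemmas apply it to commutativity and to the quadratic relation.\<close>

lemma gen_act_gen_act:
  assumes "m \<in> nim_set M"
  shows "frag_extend (gen_act i) (gen_act j m) =
    nim_act M (Fib_prod l (Fib_gen l i) (Fib_gen l j)) (frag_of m)"
proof -
  have m: "frag_of m \<in> ZZ (nim_set M)" using assms by simp
  show ?thesis
    using nim_repD(4)[OF nim_rep gen_ZZ gen_ZZ m, of i j] nim_act_gen[OF gen_act_closed[OF assms]]
    unfolding Fib_power_simps(2) bilinear_extend_of gen_act_def by metis
qed

lemma gen_act_commute:
  assumes "m \<in> nim_set M"
  shows "frag_extend (gen_act i) (gen_act j m) = frag_extend (gen_act j) (gen_act i m)"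
  unfolding gen_act_gen_act[OF assms] Fib_prod_comm[of l "Fib_gen l i" "Fib_gen l j"] ..

lemma gen_act_square:
  assumes i: "i \<in> {1..l}" and m: "m \<in> nim_set M"
  shows "frag_extend (gen_act i) (gen_act i m) = frag_of m + gen_act i m"
proof -
  have m': "frag_of m \<in> ZZ (nim_set M)" using m by simp
  have u: "frag_of (\<lambda>i\<in>{1..l}. Fib1) \<in> ZZ (fus_basis (Fib_power l))" by simp
  show ?thesis
    unfolding gen_act_gen_act[OF m] Fib_gen_square[OF i] nim_repD(3)[OF nim_rep u gen_ZZ m']
    using nim_repD(5)[OF nim_rep m'] unfolding Fib_power_simps(3) gen_act_def by metis
qed

text \<open>The generators are self-dual, so the adjunction axiom becomes symmetry of the
  matrix.\<close>

lemma gen_act_sym: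
  assumes "m \<in> nim_set M" "n \<in> nim_set M"
  shows "Poly_Mapping.lookup (gen_act i m) n = Poly_Mapping.lookup (gen_act i n) m"
proof -
  have "fus_dual (Fib_power l) (Fib_gen l i) = Fib_gen l i" by (simp add: Fib_gen_def cong: restrict_cong)
  then show ?thesis
    using nim_repD(7)[OF nim_rep _ assms, of "Fib_gen l i"] Fib_gen_basis[of l i]
    unfolding gen_act_def by (simp del: Fib_power_simps(4))
qed

text \<open>By symmetry the diagonal coefficient of the squared matrix is the sum of squares of row
  \<open>m\<close>, which is what \<open>fib_matrix_row\<close> asks for.\<close>

lemma gen_act_cases:
  assumes i: "i \<in> {1..l}" and m: "m \<in> nim_set M"
  obtains n where "n \<noteq> m" "gen_act i m = frag_of n \<or> gen_act i m = frag_of n + frag_of m"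
proof -
  let ?c = "gen_act i m"
  have K: "Poly_Mapping.keys ?c \<subseteq> nim_set M" using gen_act_closed[OF m] by simp
  have "1 + Poly_Mapping.lookup ?c m = Poly_Mapping.lookup (frag_extend (gen_act i) ?c) m"
    unfolding gen_act_square[OF i m] by (simp add: lookup_add)
  also have "\<dots> = (\<Sum>n\<in>Poly_Mapping.keys ?c. (Poly_Mapping.lookup ?c n)\<^sup>2)"
    unfolding lookup_frag_extend[OF finite_keys order_refl]
    by (intro sum.cong) (use K gen_act_sym[OF m] in \<open>auto simp: power2_eq_square\<close>)
  finally show ?thesis
    using fib_matrix_row[of ?c m] nim_repD(6)[OF nim_rep _ m] Fib_gen_basis that
    unfolding gen_act_def by (metis Fib_power_simps(1))
qed

lemma
  assumes i: "i \<in> {1..l}" and m: "m \<in> nim_set M"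
  shows partner_neq: "partner i m \<noteq> m"
    and gen_act_eq: "gen_act i m = frag_of (partner i m) + (if loop i m then frag_of m else 0)"
    and partner_closed: "partner i m \<in> nim_set M"
proof -
  obtain n where n: "n \<noteq> m" and A: "gen_act i m = frag_of n \<or> gen_act i m = frag_of n + frag_of m"
    using gen_act_cases[OF i m] .
  then have K: "Poly_Mapping.keys (gen_act i m) = {n} \<or> Poly_Mapping.keys (gen_act i m) = {n, m}"
    by (auto simp: set_eq_iff in_keys_iff lookup_add lookup_frag_of split: if_splits)
  then have p: "partner i m = n"
    unfolding partner_def using n by (intro the_equality) auto
  have "loop i m \<longleftrightarrow> gen_act i m = frag_of n + frag_of m"
    using A n unfolding loop_def by (auto simp: in_keys_iff lookup_add lookup_frag_of)
  then show "partner i m \<noteq> m" "gen_act i m = frag_of (partner i m) + (if loop i m then frag_of m else 0)"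
    using A n p by auto
  show "partner i m \<in> nim_set M" using K p gen_act_closed[OF m, of i] by auto
qed

lemma lookup_gen_act:
  assumes "i \<in> {1..l}" "m \<in> nim_set M"
  shows "Poly_Mapping.lookup (gen_act i m) x =
    of_bool (x = partner i m) + of_bool (loop i m \<and> x = m)"
  using gen_act_eq[OF assms] by (auto simp: lookup_add lookup_frag_of)

text \<open>Cancelling in the quadratic relation determines the action on the partner p of
  \<open>m\<close>: it gives m if \<open>m\<close> has a loop and m + p otherwise. The coefficients
  at m and p then yield both claims.\<close>

lemma
  assumes i: "i \<in> {1..l}" and m: "m \<in> nim_set M"
  shows partner_partner: "partner i (partner i m) = m"
    and loop_partner: "loop i (partner i m) \<longleftrightarrow> \<not> loop i m"
proof -
  let ?p = "partner i m"
  note p = partner_closed[OF i m] and q = partner_neq[OF i m]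
  have "gen_act i ?p = (if loop i m then frag_of m else frag_of m + frag_of ?p)"
    using gen_act_square[OF i m] unfolding gen_act_eq[OF i m]
    by (auto simp: frag_extend_add gen_act_eq[OF i m])
  then have *: "of_bool (x = partner i ?p) + of_bool (loop i ?p \<and> x = ?p) =
      (if loop i m then of_bool (x = m) else of_bool (x = m) + of_bool (x = ?p) :: int)" for x
    using q unfolding lookup_gen_act[OF i p, symmetric] by (auto simp: lookup_add lookup_frag_of)
  show "partner i (partner i m) = m" "loop i (partner i m) \<longleftrightarrow> \<not> loop i m"
    using *[of m] *[of ?p] q partner_neq[OF i p] by (auto split: if_splits simp: of_bool_def)
qed

lemma gen_act_gen_act_lookup:
  assumes i: "i \<in> {1..l}" and j: "j \<in> {1..l}" and m: "m \<in> nim_set M"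
  shows "Poly_Mapping.lookup (frag_extend (gen_act i) (gen_act j m)) x =
    of_bool (x = partner i (partner j m)) + of_bool (loop i (partner j m) \<and> x = partner j m) +
    of_bool (loop j m \<and> x = partner i m) + of_bool (loop j m \<and> loop i m \<and> x = m)"
  unfolding gen_act_eq[OF j m]
  by (simp add: frag_extend_add lookup_add lookup_gen_act[OF i m] lookup_gen_act[OF i partner_closed[OF j m]])

lemma
  assumes i: "i \<in> {1..l}" and j: "j \<in> {1..l}" and m: "m \<in> nim_set M"
  shows partner_commute: "partner i (partner j m) = partner j (partner i m)"
    and loop_eq: "partner i m = partner j m \<Longrightarrow> loop i m \<longleftrightarrow> loop j m"
    and loop_partner_other: "partner i m \<noteq> partner j m \<Longrightarrow> loop i (partner j m) \<longleftrightarrow> loop i m"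
proof -
  let ?p = "partner i m" and ?q = "partner j m"
  note pM = partner_closed[OF i m] and qM = partner_closed[OF j m]
  \<comment> \<open>The term at \<open>m\<close> that needs both loops is symmetric in
    \<open>i\<close> and \<open>j\<close> and cancels.\<close>
  have E: "of_bool (x = partner i ?q) + of_bool (loop i ?q \<and> x = ?q) + of_bool (loop j m \<and> x = ?p) =
     (of_bool (x = partner j ?p) + of_bool (loop j ?p \<and> x = ?p) + of_bool (loop i m \<and> x = ?q) :: int)" for x
    using arg_cong[OF gen_act_commute[OF m, of i j], of "\<lambda>v. Poly_Mapping.lookup v x"]
    unfolding gen_act_gen_act_lookup[OF i j m] gen_act_gen_act_lookup[OF j i m]
    by (simp add: conj_commute conj_left_commute)
  \<comment> \<open>The double partners avoid \<open>?p\<close> and \<open>?q\<close>, so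
    \<open>E\<close> at \<open>partner i ?q\<close> gives commutation and \<open>E\<close> at
    \<open>?q\<close> compares the two loops.\<close>
  have *: "partner i (partner j m) = partner j (partner i m) \<and> (loop i ?q \<longleftrightarrow> loop i m)" if ne: "?p \<noteq> ?q"
  proof -
    have "partner i ?q \<noteq> ?p"
      using partner_partner[OF i m] partner_partner[OF i qM] partner_neq[OF j m] by metis
    moreover have "partner j ?p \<noteq> ?q"
      using partner_partner[OF j m] partner_partner[OF j pM] partner_neq[OF i m] by metis
    moreover note partner_neq[OF i qM] partner_neq[OF j pM]
    ultimately show ?thesis
      using E[of "partner i ?q"] E[of ?q] ne by (auto simp: of_bool_def split: if_splits)
  qed
  \<comment> \<open>Both double partners are \<open>m\<close> and both loops flip, so
    \<open>E\<close> at \<open>?p\<close> reads (1 - a) + b = (1 - b) + a for the truth values a, b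
    of the two loops at \<open>m\<close>.\<close>
  have **: "partner i (partner j m) = partner j (partner i m) \<and> (loop i m \<longleftrightarrow> loop j m)" if eq: "?p = ?q"
  proof -
    have "partner i ?q = m" "partner j ?p = m" using partner_partner i j m eq by metis+
    moreover have "loop i ?q \<longleftrightarrow> \<not> loop i m" "loop j ?p \<longleftrightarrow> \<not> loop j m" using loop_partner i j m eq by metis+
    ultimately show ?thesis using E[of ?p] eq partner_neq[OF i m] by (auto simp: of_bool_def split: if_splits)
  qed
  show "partner i (partner j m) = partner j (partner i m)"
    "partner i m = partner j m \<Longrightarrow> loop i m \<longleftrightarrow> loop j m"
    "partner i m \<noteq> partner j m \<Longrightarrow> loop i (partner j m) \<longleftrightarrow> loop i m"
    using * ** by blast+
qed

text \<open>The \<open>partner i\<close> are involutions, so the complement of an invariant set is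
  invariant, and invariant sets span subrepresentations; a proper \<open>A\<close> would split the
  module. Phrasing transitivity through invariant sets avoids forming the group.\<close>

lemma indecomposable_imp_transitive:
  assumes ind: "nim_indecomposable (Fib_power l) M" and A: "A \<subseteq> nim_set M" "A \<noteq> {}"
    and cl: "\<And>i m. i \<in> {1..l} \<Longrightarrow> m \<in> A \<Longrightarrow> partner i m \<in> A"
  shows "A = nim_set M"
proof (rule ccontr)
  assume "A \<noteq> nim_set M"
  then have ne: "nim_set M - A \<noteq> {}" using A by blast
  have sub: "nim_subrep (Fib_power l) M S"
    if S: "S \<subseteq> nim_set M" and cl: "\<And>i m. i \<in> {1..l} \<Longrightarrow> m \<in> S \<Longrightarrow> partner i m \<in> S" for S
  proof (rule nim_subrep_Fib_powerI[OF nim_rep S])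
    fix i m assume i: "i \<in> {1..l}" and m: "m \<in> S"
    then have "m \<in> nim_set M" using S by blast
    have "frag_of (partner i m) \<in> ZZ S" "(if loop i m then frag_of m else 0) \<in> ZZ S"
      using cl[OF i m] m by simp_all
    then show "nim_act M (frag_of (Fib_gen l i)) (frag_of m) \<in> ZZ S"
      using gen_act_eq[OF i \<open>m \<in> nim_set M\<close>] ZZ_add unfolding gen_act_def by metis
  qed
  have "partner i m \<in> nim_set M - A" if "i \<in> {1..l}" "m \<in> nim_set M - A" for i m
    using that partner_closed partner_partner cl by (metis DiffD1 DiffD2 DiffI)
  then have sub_compl: "nim_subrep (Fib_power l) M (nim_set M - A)" by (intro sub) auto
  have sub_A: "nim_subrep (Fib_power l) M A" using A cl by (intro sub) auto
  have disj: "A \<inter> (nim_set M - A) = {}" and union: "A \<union> (nim_set M - A) = nim_set M" using A by auto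
  show False
    by (rule notE[OF ind[unfolded nim_indecomposable_def, THEN conjunct2]],
        rule exI[of _ A], rule exI[of _ "nim_set M - A"])
      (intro conjI A(2) ne disj union sub_A sub_compl)
qed

end

section \<open>Commuting involutions as coordinate flips of a cube\<close>

text \<open>Isolates the combinatorics from the module: \<open>s\<close> and \<open>t\<close> will
  be \<open>partner\<close> and \<open>loop\<close>.\<close>

locale flip_system =
  fixes I :: "'i set" and M :: "'m set" and s :: "'i \<Rightarrow> 'm \<Rightarrow> 'm" and t :: "'i \<Rightarrow> 'm \<Rightarrow> bool"
  assumes finite_I: "finite I" and nonempty: "M \<noteq> {}"
    and closed: "i \<in> I \<Longrightarrow> m \<in> M \<Longrightarrow> s i m \<in> M"
    and involution: "i \<in> I \<Longrightarrow> m \<in> M \<Longrightarrow> s i (s i m) = m"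
    and commute: "i \<in> I \<Longrightarrow> j \<in> I \<Longrightarrow> m \<in> M \<Longrightarrow> s i (s j m) = s j (s i m)"
    and flip: "i \<in> I \<Longrightarrow> m \<in> M \<Longrightarrow> t i (s i m) \<longleftrightarrow> \<not> t i m"
    and flip_same: "i \<in> I \<Longrightarrow> j \<in> I \<Longrightarrow> m \<in> M \<Longrightarrow> s i m = s j m \<Longrightarrow> t i m \<longleftrightarrow> t j m"
    and flip_other: "i \<in> I \<Longrightarrow> j \<in> I \<Longrightarrow> m \<in> M \<Longrightarrow> s i m \<noteq> s j m \<Longrightarrow> t i (s j m) \<longleftrightarrow> t i m"
    and transitive: "A \<subseteq> M \<Longrightarrow> A \<noteq> {} \<Longrightarrow> (\<And>i m. i \<in> I \<Longrightarrow> m \<in> A \<Longrightarrow> s i m \<in> A) \<Longrightarrow> A = M"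
begin

definition same :: "('i \<times> 'i) set" where
  "same = {(i, j). i \<in> I \<and> j \<in> I \<and> (\<forall>m\<in>M. s i m = s j m)}"

lemma equiv_same: "equiv I same"
  by (rule equivI) (auto simp: same_def refl_on_def sym_def trans_def)

text \<open>Commutativity makes the set of points where the two involutions agree invariant, so by
  transitivity it is empty or everything.\<close>

lemma same_if_agree:
  assumes "i \<in> I" "j \<in> I" "m \<in> M" "s i m = s j m"
  shows "(i, j) \<in> same"
proof -
  have "{m\<in>M. s i m = s j m} = M"
  proof (rule transitive)
    fix h x assume "h \<in> I" "x \<in> {m\<in>M. s i m = s j m}"
    then show "s h x \<in> {m\<in>M. s i m = s j m}"
      using closed[of h x] commute[of i h x] commute[of j h x] assms(1,2) by simp
  qed (use assms in auto)
  then show ?thesis using assms by (auto simp: same_def)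
qed

text \<open>Each class of \<open>same\<close> contributes one coordinate to \<open>f\<close>, the
  value of \<open>t\<close> at a representative. The inverse \<open>g\<close> walks from a base
  point, applying one involution per coordinate to be changed.\<close>

lemma cube_coordinates:
  obtains P k lam f g where "partition_on I P" "bij_betw lam {1..k} P"
    "f \<in> M \<rightarrow> (\<Pi>\<^sub>E j\<in>{1..k::nat}. UNIV)" "g \<in> (\<Pi>\<^sub>E j\<in>{1..k}. UNIV) \<rightarrow> M"
    "\<And>m. m \<in> M \<Longrightarrow> g (f m) = m" "\<And>e. e \<in> (\<Pi>\<^sub>E j\<in>{1..k}. UNIV) \<Longrightarrow> f (g e) = e"
    "\<And>i j m. j \<in> {1..k} \<Longrightarrow> i \<in> lam j \<Longrightarrow> m \<in> M \<Longrightarrow> f (s i m) = fib_flip j (f m)"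
    "\<And>i j m. j \<in> {1..k} \<Longrightarrow> i \<in> lam j \<Longrightarrow> m \<in> M \<Longrightarrow> f m j = FibX \<longleftrightarrow> t i m"
proof -
  define P where "P = I // same"
  have P: "partition_on I P" unfolding P_def by (rule partition_on_quotient[OF equiv_same])
  have "finite P" unfolding P_def using finite_I by (intro finite_quotient) (auto simp: same_def)
  then obtain lam where lam: "bij_betw lam {1..card P} P" using ex_bij_betw_nat_finite_1 by blast
  define k where "k = card P"
  have lamP: "lam j \<in> I // same" if "j \<in> {1..k}" for j
    using that bij_betwE[OF lam] by (simp add: k_def P_def)
  have lamI: "i \<in> I" if "j \<in> {1..k}" "i \<in> lam j" for i j
    using in_quotient_imp_subset[OF equiv_same lamP[OF that(1)]] that(2) by blast
  have lam_same: "(i, i') \<in> same \<longleftrightarrow> j = j'"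
    if "j \<in> {1..k}" "i \<in> lam j" "j' \<in> {1..k}" "i' \<in> lam j'" for i j i' j'
    using quotient_eq_iff[OF equiv_same lamP lamP, OF that(1,3,2,4)]
      inj_onD[OF bij_betw_imp_inj_on[OF lam], of j j'] that by (auto simp: k_def)
  define \<rho> where "\<rho> j = (SOME i. i \<in> lam j)" for j
  have \<rho>: "\<rho> j \<in> lam j" if "j \<in> {1..k}" for j
    unfolding \<rho>_def using in_quotient_imp_non_empty[OF equiv_same lamP[OF that]] by (simp add: some_in_eq)
  have \<rho>I: "\<rho> j \<in> I" if "j \<in> {1..k}" for j using lamI \<rho> that by blast
  define f where "f m = (\<lambda>j\<in>{1..k}. if t (\<rho> j) m then FibX else Fib1)" for m
  have fP: "f m \<in> (\<Pi>\<^sub>E j\<in>{1..k}. UNIV)" for m by (simp add: f_def)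
  have s_lam: "s i m = s (\<rho> j) m" if "j \<in> {1..k}" "i \<in> lam j" "m \<in> M" for i j m
    using lam_same[OF that(1,2,1) \<rho>[OF that(1)]] that(3) by (simp add: same_def)
  have t_lam: "f m j = FibX \<longleftrightarrow> t i m" if "j \<in> {1..k}" "i \<in> lam j" "m \<in> M" for i j m
    using flip_same[OF lamI[OF that(1,2)] \<rho>I[OF that(1)] that(3) s_lam[OF that]] that(1) by (simp add: f_def)
  have f_flip: "f (s (\<rho> j) m) = fib_flip j (f m)" if j: "j \<in> {1..k}" and m: "m \<in> M" for j m
  proof (rule extensionalityI[of _ "{1..k}"])
    fix j' assume j': "j' \<in> {1..k}"
    show "f (s (\<rho> j) m) j' = fib_flip j (f m) j'"
    proof (cases "j' = j")
      case True
      then show ?thesis using flip[OF \<rho>I[OF j] m] j by (simp add: f_def fib_flip_def)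
    next
      case False
      \<comment> \<open>Involutions of different classes agree at no point, so
        \<open>flip_other\<close> applies.\<close>
      then have "(\<rho> j', \<rho> j) \<notin> same" using lam_same j j' \<rho> by blast
      then have "s (\<rho> j') m \<noteq> s (\<rho> j) m" using same_if_agree \<rho>I j j' m by blast
      then show ?thesis using flip_other[OF \<rho>I[OF j'] \<rho>I[OF j] m] j' False by (simp add: f_def fib_flip_def)
    qed
  qed (use j in \<open>auto simp: f_def fib_flip_def extensional_def\<close>)
  obtain m0 where m0: "m0 \<in> M" using nonempty by blast
  \<comment> \<open>The walk adjusts only the coordinates in \<open>js\<close>; keeping the list as
    a parameter allows induction on it.\<close>
  define G where "G js e = foldr (\<lambda>j m. if e j \<noteq> f m0 j then s (\<rho> j) m else m) js m0" for js e
  have G_simps: "G [] e = m0" "G (j # js) e = (if e j \<noteq> f m0 j then s (\<rho> j) (G js e) else G js e)" for j js e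
    by (simp_all add: G_def)
  have GM: "G js e \<in> M" if "set js \<subseteq> {1..k}" for js e
    using that by (induction js) (auto simp: G_simps m0 closed \<rho>I)
  have fib_neq: "(if x = Fib1 then FibX else Fib1) = y \<longleftrightarrow> x \<noteq> y" for x y
    by (cases x; cases y) auto
  have fG: "f (G js e) j = (if j \<in> set js then e j else f m0 j)" if "set js \<subseteq> {1..k}" "distinct js" for js e j
    using that
  proof (induction js)
    case (Cons x js)
    then show ?case using f_flip[of x "G js e"] GM[of js e] by (auto simp: G_simps fib_flip_def fib_neq)
  qed (simp add: G_simps)
  \<comment> \<open>Flipping coordinate \<open>j\<close> of \<open>e\<close> toggles one application
    of \<open>s (\<rho> j)\<close>; commutativity brings it to the front, where the involution law
    absorbs a double application.\<close>
  have G_flip: "G js (fib_flip j e) = (if j \<in> set js then s (\<rho> j) (G js e) else G js e)"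
    if "set js \<subseteq> {1..k}" "distinct js" "j \<in> {1..k}" for js e j
    using that
  proof (induction js)
    case (Cons x js)
    then have x: "x \<in> {1..k}" and GM': "G js e \<in> M" using GM by auto
    have IH: "G js (fib_flip j e) = (if j \<in> set js then s (\<rho> j) (G js e) else G js e)" using Cons by auto
    show ?case
    proof (cases "x = j")
      case True
      then have "fib_flip j e x \<noteq> f m0 x \<longleftrightarrow> e x = f m0 x" by (auto simp: fib_flip_def fib_neq)
      then show ?thesis using IH True Cons.prems involution[OF \<rho>I[OF x] GM'] by (auto simp: G_simps)
    next
      case False
      then have "fib_flip j e x = e x" by (simp add: fib_flip_def)
      then show ?thesis
        using IH False Cons.prems commute[OF \<rho>I[OF x] \<rho>I[of j] GM'] by (auto simp: G_simps)
    qed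
  qed (simp add: G_simps)
  define g where "g = G [1..<Suc k]"
  have js: "set [1..<Suc k] = {1..k}" "distinct [1..<Suc k]" by auto
  have gM: "g e \<in> M" for e unfolding g_def using GM js by blast
  have fg: "f (g e) = e" if "e \<in> (\<Pi>\<^sub>E j\<in>{1..k}. UNIV)" for e
  proof (rule extensionalityI[of _ "{1..k}"])
    fix j assume "j \<in> {1..k}"
    then show "f (g e) j = e j" using fG[OF eq_refl[OF js(1)] js(2), of e j] unfolding g_def js(1) by simp
  qed (use that fP[of "g e"] in \<open>simp_all add: PiE_iff\<close>)
  have g_flip: "g (fib_flip j e) = s (\<rho> j) (g e)" if "j \<in> {1..k}" for j e
    using G_flip[OF eq_refl[OF js(1)] js(2) that, of e] that unfolding g_def js(1) by simp
  \<comment> \<open>The image is invariant because \<open>g\<close> carries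
    \<open>fib_flip j\<close> to the involutions of class \<open>j\<close>. Surjectivity of
    \<open>g\<close> upgrades \<open>fg\<close> to a two-sided inverse.\<close>
  have "g ` (\<Pi>\<^sub>E j\<in>{1..k}. UNIV) = M"
  proof (rule transitive)
    fix i m assume i: "i \<in> I" and "m \<in> g ` (\<Pi>\<^sub>E j\<in>{1..k}. UNIV)"
    then obtain e where e: "e \<in> (\<Pi>\<^sub>E j\<in>{1..k}. UNIV)" "m = g e" by blast
    obtain p where "p \<in> P" "i \<in> p" using i partition_onD1[OF P] by blast
    then obtain j where j: "j \<in> {1..k}" "i \<in> lam j"
      using bij_betw_imp_surj_on[OF lam] unfolding k_def by blast
    have "s i m = g (fib_flip j e)" using s_lam[OF j gM] g_flip[OF j(1)] e by simp
    moreover have "fib_flip j e \<in> (\<Pi>\<^sub>E j\<in>{1..k}. UNIV)"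
      using e j by (auto simp: fib_flip_def PiE_iff extensional_def)
    ultimately show "s i m \<in> g ` (\<Pi>\<^sub>E j\<in>{1..k}. UNIV)" by blast
  qed (use gM fP in auto)
  then have gf: "g (f m) = m" if "m \<in> M" for m using that fg by (metis imageE)
  show ?thesis
  proof (rule that[OF P lam[folded k_def]])
    show "f (s i m) = fib_flip j (f m)" if "j \<in> {1..k}" "i \<in> lam j" "m \<in> M" for i j m
      using s_lam[OF that] f_flip[OF that(1,3)] by simp
  qed (use fP gM gf fg t_lam in auto)
qed

end

section \<open>The isomorphism with a partition module\<close>

theorem theorem21:
  fixes l :: nat and M :: "(nat \<Rightarrow> fib, 'm) nim_data"
  assumes "l \<ge> 1"
    and "nim_rep (Fib_power l) M"
    and "nim_indecomposable (Fib_power l) M"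
  shows "\<exists>P k lam. partition_on {1..l} P \<and> bij_betw lam {1..k} P \<and>
           nim_isomorphic (Fib_power l) M (Fib_partition l k lam)"
proof -
  interpret fib_action l M by unfold_locales (rule assms(2))
  interpret flip_system "{1..l}" "nim_set M" partner loop
  proof
    show "nim_set M \<noteq> {}" using assms(3) by (simp add: nim_indecomposable_def)
  qed (fact finite_atLeastAtMost partner_closed partner_partner partner_commute loop_partner loop_eq
      loop_partner_other indecomposable_imp_transitive[OF assms(3)])+
  obtain P k lam f g where P: "partition_on {1..l} P" and lam: "bij_betw lam {1..k} P"
    and f: "f \<in> nim_set M \<rightarrow> (\<Pi>\<^sub>E j\<in>{1..k::nat}. UNIV)" and g: "g \<in> (\<Pi>\<^sub>E j\<in>{1..k}. UNIV) \<rightarrow> nim_set M"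
    and gf: "\<And>m. m \<in> nim_set M \<Longrightarrow> g (f m) = m" and fg: "\<And>e. e \<in> (\<Pi>\<^sub>E j\<in>{1..k}. UNIV) \<Longrightarrow> f (g e) = e"
    and fs: "\<And>i j m. j \<in> {1..k} \<Longrightarrow> i \<in> lam j \<Longrightarrow> m \<in> nim_set M \<Longrightarrow> f (partner i m) = fib_flip j (f m)"
    and ft: "\<And>i j m. j \<in> {1..k} \<Longrightarrow> i \<in> lam j \<Longrightarrow> m \<in> nim_set M \<Longrightarrow> f m j = FibX \<longleftrightarrow> loop i m"
    by (rule cube_coordinates) blast
  let ?N = "Fib_partition l k lam"
  note N = nim_rep_Fib_partition[OF P lam] and setN = nim_set_Fib_partition[OF P lam]
  have mor: "nim_morphism (Fib_power l) M ?N f"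
  proof (rule nim_morphism_Fib_powerI[OF assms(2) N])
    show "f \<in> nim_set M \<rightarrow> nim_set ?N" using f by (simp only: setN)
    fix i m assume i: "i \<in> {1..l}" and m: "m \<in> nim_set M"
    obtain p where "p \<in> P" "i \<in> p" using i partition_onD1[OF P] by blast
    then obtain j where j: "j \<in> {1..k}" "i \<in> lam j" using bij_betw_imp_surj_on[OF lam] by blast
    have "f m \<in> (\<Pi>\<^sub>E j\<in>{1..k}. UNIV)" using f m by blast
    \<comment> \<open>In \<open>?N\<close> the generator indexed by \<open>i\<close> acts as the one
      indexed by its part \<open>j\<close>; \<open>fs\<close> and \<open>ft\<close> match the
      resulting flip and diagonal term with \<open>gen_act_eq\<close>.\<close>
    then have "nim_act ?N (frag_of (Fib_gen l i)) (frag_of (f m)) =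
        frag_of (fib_flip j (f m)) + (if f m j = FibX then frag_of (f m) else 0)"
      unfolding nim_act_Fib_partition_gen[OF P lam j] using Fib_prod_gen[OF _ j(1)] by simp
    then show "frag_extend (\<lambda>m. frag_of (f m)) (nim_act M (frag_of (Fib_gen l i)) (frag_of m)) =
       nim_act ?N (frag_of (Fib_gen l i)) (frag_of (f m))"
      using gen_act_eq[OF i m] fs[OF j m] ft[OF j m] unfolding gen_act_def
      by (simp add: frag_extend_add)
  qed
  have inv: "nim_morphism (Fib_power l) ?N M g"
    by (rule nim_morphism_inverse[OF assms(2) N mor]) (use g gf fg setN in auto)
  have "nim_isomorphic (Fib_power l) M ?N"
    unfolding nim_isomorphic_def setN
    by (rule exI[of _ f], rule exI[of _ g]) (intro conjI ballI mor inv gf fg)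
  with P lam show ?thesis by (intro exI conjI)
qed

end
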